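(* The Balanced Connected Subgraph problem (BCS) on bicolored graphs with $n$ vertices can be solved in $O^*(2^{n/2})$ time, i.e. in time $2^{n/2}\cdot n^{O(1)}$.
   Context: All graphs are finite, simple and undirected. A graph is bicolored if every vertex is colored blue or red (adjacent vertices may have the same color); $B$ and $R$ denote the sets of blue and red vertices. The Balanced Connected Subgraph problem (BCS): the input is a bicolored graph $G=(B\cup R,E)$; the output is a connected induced subgraph $H$ of $G$ with $|V(H)\cap B|=|V(H)\cap R|$ having the maximum number of vertices. The empty subgraph (of size $0$) counts as feasible, so an optimum always exists. The notation $O^*(\cdot)$ suppresses factors polynomial in $n$. *)

theory Defs
  imports
    Complex_Main
    "HOL-Computational_Algebra.Polynomial"
    "Graph_Theory.Digraph_Component"
begin

section \<open>The Balanced Connected Subgraph problem\<close>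

text \<open>
  \<^const>\<open>pair_graph\<close> (finite, symmetric, loop-free, no parallel arcs) is the library's notion of a
  finite simple undirected graph: an edge is represented by its two opposite arcs.
\<close>

definition bicolored_graph :: "'a pair_pre_digraph \<Rightarrow> 'a set \<Rightarrow> 'a set \<Rightarrow> bool" where
  "bicolored_graph G B R \<longleftrightarrow> pair_graph G \<and> pverts G = B \<union> R \<and> B \<inter> R = {}"

text \<open>
  The library's \<^const>\<open>Digraph_Component.connected\<close> is false for the graph without vertices, which
  is a feasible solution here and hence is admitted separately.
\<close>

definition BCS_feasible ::
  "'a pair_pre_digraph \<Rightarrow> 'a set \<Rightarrow> 'a set \<Rightarrow> 'a pair_pre_digraph \<Rightarrow> bool" where
  "BCS_feasible G B R H \<longleftrightarrow>
     induced_subgraph (with_proj H) (with_proj G) \<and>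
     (pverts H = {} \<or> Digraph_Component.connected (with_proj H)) \<and>
     card (pverts H \<inter> B) = card (pverts H \<inter> R)"

definition BCS_optimal ::
  "'a pair_pre_digraph \<Rightarrow> 'a set \<Rightarrow> 'a set \<Rightarrow> 'a pair_pre_digraph \<Rightarrow> bool" where
  "BCS_optimal G B R H \<longleftrightarrow>
     BCS_feasible G B R H \<and>
     (\<forall>H'. BCS_feasible G B R H' \<longrightarrow> card (pverts H') \<le> card (pverts H))"


section \<open>Machine model\<close>

text \<open>
  Algorithms are programs of a first-order language with recursive functions whose only data are
  binary trees (LISP with a single atom). The running time is the number of evaluation steps.

  Every step is a constant number of pointer operations: there is no arithmetic, no comparison of
  trees beyond testing for the atom, and a step allocates at most one cell; environments have a
  length bounded by the program. So a computation of \<open>t\<close> steps costs \<open>O(t log t)\<close> on a RAM with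
  logarithmic costs, and conversely such a RAM is simulated with overhead \<open>O(log t)\<close> by keeping its
  memory in a balanced tree. For \<open>t = 2 ^ O(n)\<close> these overheads are polynomial in \<open>n\<close>.
\<close>

datatype sexp = Atom | Pair sexp sexp

fun hd_sexp :: "sexp \<Rightarrow> sexp" where
  "hd_sexp Atom = Atom"
| "hd_sexp (Pair x y) = x"

fun tl_sexp :: "sexp \<Rightarrow> sexp" where
  "tl_sexp Atom = Atom"
| "tl_sexp (Pair x y) = y"

text \<open>
  \<open>EVar i\<close> is the \<open>i\<close>-th value of the environment, \<open>ELet a b\<close> evaluates \<open>b\<close> with the value of \<open>a\<close>
  pushed in front of the environment (de Bruijn indices), and \<open>ECall f as\<close> evaluates the body of
  the \<open>f\<close>-th function of the program in the environment consisting of the values of \<open>as\<close>.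
\<close>

datatype expr =
    EVar nat
  | EAtom
  | EPair expr expr
  | EHd expr
  | ETl expr
  | EIf expr expr expr
  | ELet expr expr
  | ECall nat "expr list"

type_synonym program = "expr list"

text \<open>\<open>eval P \<rho> e v t\<close>: under the environment \<open>\<rho>\<close>, \<open>e\<close> evaluates to \<open>v\<close> in exactly \<open>t\<close> steps.\<close>

inductive
  eval :: "program \<Rightarrow> sexp list \<Rightarrow> expr \<Rightarrow> sexp \<Rightarrow> nat \<Rightarrow> bool" and
  evals :: "program \<Rightarrow> sexp list \<Rightarrow> expr list \<Rightarrow> sexp list \<Rightarrow> nat \<Rightarrow> bool"
  for P :: program
where
  eval_Var: "i < length \<rho> \<Longrightarrow> eval P \<rho> (EVar i) (\<rho> ! i) 1"
| eval_Atom: "eval P \<rho> EAtom Atom 1"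
| eval_Pair: "eval P \<rho> a x s \<Longrightarrow> eval P \<rho> b y t \<Longrightarrow> eval P \<rho> (EPair a b) (Pair x y) (s + t + 1)"
| eval_Hd: "eval P \<rho> a x s \<Longrightarrow> eval P \<rho> (EHd a) (hd_sexp x) (s + 1)"
| eval_Tl: "eval P \<rho> a x s \<Longrightarrow> eval P \<rho> (ETl a) (tl_sexp x) (s + 1)"
| eval_If_Pair:
    "eval P \<rho> c x s \<Longrightarrow> x \<noteq> Atom \<Longrightarrow> eval P \<rho> a y t \<Longrightarrow> eval P \<rho> (EIf c a b) y (s + t + 1)"
| eval_If_Atom:
    "eval P \<rho> c Atom s \<Longrightarrow> eval P \<rho> b y t \<Longrightarrow> eval P \<rho> (EIf c a b) y (s + t + 1)"
| eval_Let: "eval P \<rho> a x s \<Longrightarrow> eval P (x # \<rho>) b y t \<Longrightarrow> eval P \<rho> (ELet a b) y (s + t + 1)"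
| eval_Call:
    "evals P \<rho> as xs s \<Longrightarrow> f < length P \<Longrightarrow> eval P xs (P ! f) y t \<Longrightarrow>
     eval P \<rho> (ECall f as) y (s + t + 1)"
| evals_Nil: "evals P \<rho> [] [] 0"
| evals_Cons:
    "eval P \<rho> a x s \<Longrightarrow> evals P \<rho> as xs t \<Longrightarrow> evals P \<rho> (a # as) (x # xs) (s + t)"

inductive_cases eval_elims:
  "eval P \<rho> (EVar i) v t"
  "eval P \<rho> EAtom v t"
  "eval P \<rho> (EPair a b) v t"
  "eval P \<rho> (EHd a) v t"
  "eval P \<rho> (ETl a) v t"
  "eval P \<rho> (EIf c a b) v t"
  "eval P \<rho> (ELet a b) v t"
  "eval P \<rho> (ECall f as) v t"
  "evals P \<rho> [] vs t"
  "evals P \<rho> (a # as) vs t"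

lemma eval_deterministic:
  "eval P \<rho> e v t \<Longrightarrow> eval P \<rho> e v' t' \<Longrightarrow> v' = v \<and> t' = t"
  and evals_deterministic:
  "evals P \<rho> es vs t \<Longrightarrow> evals P \<rho> es vs' t' \<Longrightarrow> vs' = vs \<and> t' = t"
proof (induction arbitrary: v' t' and vs' t' rule: eval_evals.inducts)
  case (eval_Var i \<rho>)
  then show ?case by (auto elim: eval_elims(1))
next
  case (eval_Atom \<rho>)
  then show ?case by (auto elim: eval_elims(2))
next
  case eval_Pair
  from eval_Pair.prems show ?case
    by (rule eval_elims(3)) (auto dest!: eval_Pair.IH(2,4))
next
  case eval_Hd
  from eval_Hd.prems show ?case
    by (rule eval_elims(4)) (auto dest!: eval_Hd.IH(2))
next
  case eval_Tl
  from eval_Tl.prems show ?case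
    by (rule eval_elims(5)) (auto dest!: eval_Tl.IH(2))
next
  case eval_If_Pair
  from eval_If_Pair.prems show ?case
    by (rule eval_elims(6)) (auto dest!: eval_If_Pair.IH(2,4) simp: eval_If_Pair.hyps)
next
  case eval_If_Atom
  from eval_If_Atom.prems show ?case
    by (rule eval_elims(6)) (auto dest!: eval_If_Atom.IH(2,4))
next
  case eval_Let
  from eval_Let.prems show ?case
    by (rule eval_elims(7)) (auto dest!: eval_Let.IH(2,4))
next
  case eval_Call
  from eval_Call.prems show ?case
    by (rule eval_elims(8)) (auto dest!: eval_Call.IH(2,5))
next
  case evals_Cons
  from evals_Cons.prems show ?case
    by (rule eval_elims(10)) (auto dest!: evals_Cons.IH(2,4))
next
  case (evals_Nil \<rho>)
  then show ?case by (auto elim: eval_elims(9))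
qed

text \<open>Program \<open>P\<close>, started in its function \<open>0\<close> on input \<open>x\<close>, returns \<open>y\<close> after \<open>t\<close> steps.\<close>

definition computes_in :: "program \<Rightarrow> sexp \<Rightarrow> sexp \<Rightarrow> nat \<Rightarrow> bool" where
  "computes_in P x y t \<longleftrightarrow> eval P [x] (ECall 0 [EVar 0]) y t"


section \<open>Encoding of instances and solutions\<close>

fun sexp_of_bool :: "bool \<Rightarrow> sexp" where
  "sexp_of_bool False = Atom"
| "sexp_of_bool True = Pair Atom Atom"

fun sexp_of_list :: "sexp list \<Rightarrow> sexp" where
  "sexp_of_list [] = Atom"
| "sexp_of_list (x # xs) = Pair x (sexp_of_list xs)"

text \<open>
  With respect to a listing \<open>vs\<close> of the vertices, an instance is the list that holds, for every
  vertex, its color (true for blue) and its row of the adjacency matrix; a set of vertices is its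
  list of membership bits.
\<close>

definition encode_instance :: "'a list \<Rightarrow> 'a pair_pre_digraph \<Rightarrow> 'a set \<Rightarrow> sexp" where
  "encode_instance vs G B =
     sexp_of_list
       (map (\<lambda>v. Pair (sexp_of_bool (v \<in> B))
                      (sexp_of_list (map (\<lambda>w. sexp_of_bool ((v, w) \<in> parcs G)) vs))) vs)"

definition encode_vertex_set :: "'a list \<Rightarrow> 'a set \<Rightarrow> sexp" where
  "encode_vertex_set vs S = sexp_of_list (map (\<lambda>v. sexp_of_bool (v \<in> S)) vs)"


section \<open>Running times\<close>

definition O_star :: "(nat \<Rightarrow> real) \<Rightarrow> (nat \<Rightarrow> real) set" where
  "O_star f = {T. \<exists>p :: real poly. \<forall>n. T n \<le> poly p (real n) * f n}"

text \<open>
  The algorithm must be correct and stay within time \<open>T n\<close> on every bicolored graph with \<open>n\<close>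
  vertices, in whatever order the vertices are listed. Vertices are natural numbers because the
  program must not depend on the vertex type.
\<close>

definition solves_BCS_in_time :: "program \<Rightarrow> (nat \<Rightarrow> real) \<Rightarrow> bool" where
  "solves_BCS_in_time P T \<longleftrightarrow>
     (\<forall>(G :: nat pair_pre_digraph) B R vs.
        bicolored_graph G B R \<longrightarrow> distinct vs \<longrightarrow> set vs = pverts G \<longrightarrow>
        (\<exists>H t. computes_in P (encode_instance vs G B) (encode_vertex_set vs (pverts H)) t \<and>
               BCS_optimal G B R H \<and>
               real t \<le> T (card (pverts G))))"

end

theory Submission
  imports Defs
begin

text \<open>
  Let \<open>M\<close> be the smaller color class, so \<open>card M \<le> n div 2\<close>. A balanced connected subgraph with \<open>2k\<close>
  vertices exists iff some \<open>X \<subseteq> M\<close> with \<open>k\<close> elements satisfies: \<open>X\<close> lies in a connected set that contains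
  no further vertex of \<open>M\<close> and at most \<open>k\<close> others, and the component of \<open>X\<close> in the graph induced by
  \<open>X \<union> - M\<close> has at least \<open>k\<close> vertices outside \<open>M\<close>; one then grows the former set inside the latter.
  The first condition says that there is a branching walk (an ordered tree mapped to the graph) with
  \<open>2k\<close> nodes that visits all of \<open>X\<close> and nothing else in \<open>M\<close>. For each \<open>Y \<subseteq> M\<close> the branching walks
  avoiding \<open>M - Y\<close> are counted in polynomial time, and inclusion-exclusion over \<open>Y \<subseteq> X\<close>, done for all
  \<open>X\<close> at once by the fast Moebius transform, yields the numbers of walks that visit all of \<open>X\<close>. All
  this takes \<open>2 ^ card M\<close> times a polynomial. A solution is extracted by determining the largest \<open>k\<close>
  and then deleting vertices as long as the answer for \<open>k\<close> stays positive.
\<close>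

section \<open>Connected sets and branching walks\<close>

text \<open>Why walks and not trees: a recurrence for subtrees would have to remember which vertices
  are used. A branching walk may repeat vertices, so its recurrence needs only the root and the
  number of nodes. The price is that a walk with 2k nodes may visit fewer than 2k vertices; it
  certifies a connected set that is not too large, never one that is large enough. The lower bound
  must therefore come from a separate reachability test. Both tests are confined to
  \<open>X \<union> (D - M)\<close>, where \<open>D\<close> is the set of vertices not yet deleted;
  so every set between the two meets \<open>M\<close> in exactly \<open>X\<close>, and only its size
  has to be adjusted.

  Evaluating an alternating sum separately for each X would take 3^|M| summands in total; sharing
  them along a fixed order of the vertices brings this down to 2^|M| up to a polynomial. Negative
  numbers are avoided by keeping each alternating sum as a pair of naturals, of which only equality
  is tested. All counts have O(n^2) bits, so that bitwise arithmetic on them stays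
  polynomial.\<close>

definition cut_connected :: "('a \<Rightarrow> 'a \<Rightarrow> bool) \<Rightarrow> 'a set \<Rightarrow> bool" where
  "cut_connected E S \<longleftrightarrow>
     S \<noteq> {} \<and> (\<forall>T. T \<subset> S \<longrightarrow> T \<noteq> {} \<longrightarrow> (\<exists>x\<in>T. \<exists>y\<in>S - T. E x y))"

lemma cut_connected_nonempty: "cut_connected E S \<Longrightarrow> S \<noteq> {}"
  by (simp add: cut_connected_def)

text \<open>This is the form in which all growth arguments use connectivity: T is the part reached
  so far, possibly larger than its part in S, and an edge inside S leads out of it.\<close>

lemma cut_connectedE:
  assumes "cut_connected E S" "S \<inter> T \<noteq> {}" "\<not> S \<subseteq> T"
  obtains x y where "x \<in> S \<inter> T" "y \<in> S - T" "E x y"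
proof -
  have "S \<inter> T \<subset> S" using assms(3) by auto
  with assms(1,2) obtain x y where "x \<in> S \<inter> T" "y \<in> S - (S \<inter> T)" "E x y"
    unfolding cut_connected_def by meson
  then show ?thesis using that by auto
qed

text \<open>A cut without a leaving edge contains each of S and T entirely or misses it, so it
  separates S from T; the link together with the symmetry of E excludes this.\<close>

lemma cut_connected_union:
  assumes E: "symp E" and S: "cut_connected E S" and T: "cut_connected E T"
    and link: "S \<inter> T \<noteq> {} \<or> (\<exists>x\<in>S. \<exists>y\<in>T. E x y)"
  shows "cut_connected E (S \<union> T)"
  unfolding cut_connected_def
proof (intro conjI allI impI)
  show "S \<union> T \<noteq> {}" using cut_connected_nonempty[OF S] by blast
next
  fix A assume A: "A \<subset> S \<union> T" "A \<noteq> {}"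
  show "\<exists>x\<in>A. \<exists>y\<in>S \<union> T - A. E x y"
  proof (rule ccontr)
    assume no: "\<not> ?thesis"
    have S': "S \<inter> A = {} \<or> S \<subseteq> A"
    proof (rule ccontr)
      assume "\<not> ?thesis"
      then obtain x y where "x \<in> S \<inter> A" "y \<in> S - A" "E x y" using cut_connectedE[OF S] by metis
      then show False using no by blast
    qed
    have T': "T \<inter> A = {} \<or> T \<subseteq> A"
    proof (rule ccontr)
      assume "\<not> ?thesis"
      then obtain x y where "x \<in> T \<inter> A" "y \<in> T - A" "E x y" using cut_connectedE[OF T] by metis
      then show False using no by blast
    qed
    from S' T' A have "(S \<subseteq> A \<and> T \<inter> A = {}) \<or> (T \<subseteq> A \<and> S \<inter> A = {})" by blast
    with link no show False using sympD[OF E] by blast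
  qed
qed

lemma cut_connected_singleton: "cut_connected E {v}"
  by (auto simp: cut_connected_def)

lemma cut_connected_insert:
  assumes "symp E" "cut_connected E S" "x \<in> S" "E x y"
  shows "cut_connected E (insert y S)"
  using cut_connected_union[OF assms(1,2) cut_connected_singleton[of E y]] assms(3,4) by auto

text \<open>Discrete continuity: vertices of U are added one at a time, so no cardinality is
  skipped. Here a set that is at most large enough and one that is at least large enough yield one
  of the exact size.\<close>

lemma cut_connected_interpolate:
  assumes "symp E" "cut_connected E S" "cut_connected E U" "S \<subseteq> U" "finite U"
    "card S \<le> k" "k \<le> card U"
  obtains T where "S \<subseteq> T" "T \<subseteq> U" "cut_connected E T" "card T = k"
proof -
  have "\<exists>T. S \<subseteq> T \<and> T \<subseteq> U \<and> cut_connected E T \<and> card T = k"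
    using assms(6,7)
  proof (induction k rule: dec_induct)
    case base
    then show ?case using assms(2,4) by auto
  next
    case (step j)
    then obtain T where T: "S \<subseteq> T" "T \<subseteq> U" "cut_connected E T" "card T = j" by auto
    have "U \<inter> T \<noteq> {}" using T(2) cut_connected_nonempty[OF T(3)] by blast
    moreover have "\<not> U \<subseteq> T"
      using T(2,4) step.prems by auto
    ultimately obtain x y where xy: "x \<in> U \<inter> T" "y \<in> U - T" "E x y"
      using cut_connectedE[OF assms(3)] by metis
    have "cut_connected E (insert y T)" using cut_connected_insert[OF assms(1) T(3)] xy by auto
    moreover have "card (insert y T) = Suc j"
      using xy T finite_subset[OF T(2) assms(5)] by auto
    ultimately show ?case using T xy by (intro exI[of _ "insert y T"]) auto
  qed
  then show ?thesis using that by blast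
qed

section \<open>Branching walks\<close>

datatype 'a btree = Lf 'a | Jn "'a btree" "'a btree"

text \<open>\<open>Jn s t\<close> hangs t below the root of s as a new last child. Thus a binary
  tree with m leaves codes an ordered tree with m nodes, and \<open>nodes\<close> counts the
  leaves.\<close>

primrec root :: "'a btree \<Rightarrow> 'a" where
  "root (Lf v) = v"
| "root (Jn s t) = root s"

primrec nodes :: "'a btree \<Rightarrow> nat" where
  "nodes (Lf v) = 1"
| "nodes (Jn s t) = nodes s + nodes t"

primrec supp :: "'a btree \<Rightarrow> 'a set" where
  "supp (Lf v) = {v}"
| "supp (Jn s t) = supp s \<union> supp t"

primrec walk :: "('a \<Rightarrow> 'a \<Rightarrow> bool) \<Rightarrow> 'a btree \<Rightarrow> bool" where
  "walk E (Lf v) = True"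
| "walk E (Jn s t) = (walk E s \<and> walk E t \<and> E (root s) (root t))"

lemma root_in_supp: "root t \<in> supp t"
  by (induction t) auto

lemma finite_supp: "finite (supp t)"
  by (induction t) auto

lemma nodes_pos: "nodes t > 0"
  by (induction t) auto

lemma card_supp_le: "card (supp t) \<le> nodes t"
proof (induction t)
  case (Jn s t)
  then show ?case using card_Un_le[of "supp s" "supp t"] by simp
qed simp

lemma cut_connected_supp:
  assumes "symp E"
  shows "walk E t \<Longrightarrow> cut_connected E (supp t)"
proof (induction t)
  case (Lf v)
  then show ?case by (simp add: cut_connected_singleton)
next
  case (Jn s t)
  then show ?case
    using cut_connected_union[OF assms, of "supp s" "supp t"] root_in_supp by fastforce
qed

lemma walk_extend:
  assumes "walk E t" "x \<in> supp t" "E x y"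
  obtains t' where "walk E t'" "root t' = root t" "nodes t' = Suc (nodes t)" "supp t' = insert y (supp t)"
proof -
  have "\<exists>t'. walk E t' \<and> root t' = root t \<and> nodes t' = Suc (nodes t) \<and> supp t' = insert y (supp t)"
    using assms(1,2)
  proof (induction t)
    case (Lf v)
    then show ?case using assms(3) by (intro exI[of _ "Jn (Lf v) (Lf y)"]) auto
  next
    case (Jn s t)
    show ?case
    proof (cases "x \<in> supp s")
      case True
      then obtain s' where "walk E s' \<and> root s' = root s \<and> nodes s' = Suc (nodes s) \<and> supp s'
          = insert y (supp s)"
        using Jn by auto
      then show ?thesis using Jn.prems by (intro exI[of _ "Jn s' t"]) auto
    next
      case False
      then obtain t' where "walk E t' \<and> root t' = root t \<and> nodes t' = Suc (nodes t) \<and> supp t'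
          = insert y (supp t)"
        using Jn by auto
      then show ?thesis using Jn.prems by (intro exI[of _ "Jn s t'"]) auto
    qed
  qed
  then show ?thesis using that by blast
qed

text \<open>The walk is a spanning tree of S grown edge by edge; no vertex occurs twice, hence the
  exact number of nodes. Conversely a walk only gives \<open>card_supp_le\<close>, because of
  repetitions.\<close>

lemma cut_connected_imp_walk:
  assumes "cut_connected E S" "finite S"
  obtains t where "walk E t" "nodes t = card S" "supp t = S"
proof -
  obtain v where v: "v \<in> S" using cut_connected_nonempty[OF assms(1)] by blast
  have "\<exists>t. walk E t \<and> nodes t = k \<and> supp t \<subseteq> S \<and> card (supp t) = k" if "1 \<le> k" "k \<le> card S" for k
    using that
  proof (induction k rule: dec_induct)
    case base
    then show ?case using v by (intro exI[of _ "Lf v"]) auto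
  next
    case (step j)
    then obtain t where t: "walk E t" "nodes t = j" "supp t \<subseteq> S" "card (supp t) = j" by auto
    have "S \<inter> supp t \<noteq> {}" using t(3) root_in_supp[of t] by blast
    moreover have "\<not> S \<subseteq> supp t"
      using t(3,4) step.prems by auto
    ultimately obtain x y where xy: "x \<in> S \<inter> supp t" "y \<in> S - supp t" "E x y"
      using cut_connectedE[OF assms(1)] by metis
    obtain t' where "walk E t'" "nodes t' = Suc (nodes t)" "supp t' = insert y (supp t)"
      using walk_extend[OF t(1) _ xy(3)] xy by auto
    then show ?case using t xy finite_supp[of t] by (intro exI[of _ t']) auto
  qed
  from this[of "card S"] obtain t where "walk E t" "nodes t = card S" "supp t \<subseteq> S"
      "card (supp t) = card S"
    using v assms(2) by (metis Suc_leI card_gt_0_iff empty_iff One_nat_def order_refl)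
  then show ?thesis using that card_subset_eq[OF assms(2)] by blast
qed

section \<open>Counting branching walks\<close>

locale listed_graph =
  fixes vs :: "'a list" and E :: "'a \<Rightarrow> 'a \<Rightarrow> bool"
  assumes distinct_vs: "distinct vs" and symp_E: "symp E"
begin

abbreviation V :: "'a set" where "V \<equiv> set vs"

definition n :: nat where "n = length vs"

definition walks_at :: "'a set \<Rightarrow> nat \<Rightarrow> 'a \<Rightarrow> 'a btree set" where
  "walks_at S m v = {t. walk E t \<and> nodes t = m \<and> root t = v \<and> supp t \<subseteq> S}"

definition W :: "'a set \<Rightarrow> nat \<Rightarrow> 'a \<Rightarrow> nat" where
  "W S m v = card (walks_at S m v)"

definition nbr_sum :: "('a \<Rightarrow> nat) \<Rightarrow> 'a \<Rightarrow> nat" where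
  "nbr_sum f v = (\<Sum>w\<leftarrow>vs. if E v w then f w else 0)"

lemma nbr_sum_eq: "nbr_sum f v = (\<Sum>w\<in>{w\<in>V. E v w}. f w)"
  unfolding nbr_sum_def using distinct_vs
  by (simp add: sum_list_distinct_conv_sum_set sum.inter_filter[symmetric])

lemma nbr_sum_le: "(\<And>w. w \<in> V \<Longrightarrow> f w \<le> B) \<Longrightarrow> nbr_sum f v \<le> n * B"
  unfolding nbr_sum_def n_def
  using sum_list_mono[of vs "\<lambda>w. if E v w then f w else 0" "\<lambda>_. B"]
  by (auto simp: sum_list_triv)

lemma walks_at_1: "walks_at S 1 v = (if v \<in> S then {Lf v} else {})"
proof -
  have "\<exists>v. t = Lf v" if "nodes t = 1" for t :: "'a btree"
  proof (cases t)
    case (Jn s u)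
    then show ?thesis using that nodes_pos[of s] nodes_pos[of u] by simp
  qed simp
  then have "walks_at S 1 v = {t. t = Lf v \<and> v \<in> S}"
    unfolding walks_at_def by fastforce
  then show ?thesis by simp
qed

text \<open>The outermost join splits off the last child of the root: the rest keeps the root v, and
  the child is a neighbour w. Since \<open>Jn\<close> is injective and both parts determine a and w,
  the pieces are disjoint, which turns this equation into the recurrence for the counts.\<close>

lemma walks_at_rec:
  assumes "m \<ge> 2"
  shows "walks_at S m v = (\<Union>a\<in>{1..<m}. \<Union>w\<in>{w\<in>S. E v w}.
           (\<lambda>(s, t). Jn s t) ` (walks_at S a v \<times> walks_at S (m - a) w))"
proof (intro set_eqI iffI)
  fix t assume "t \<in> walks_at S m v"
  then have t: "walk E t" "nodes t = m" "root t = v" "supp t \<subseteq> S" by (auto simp: walks_at_def)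
  with assms obtain s u where su: "t = Jn s u" by (cases t) auto
  have "nodes s \<in> {1..<m}" "root u \<in> {w\<in>S. E v w}"
    using t su nodes_pos[of s] nodes_pos[of u] root_in_supp[of u] by auto
  moreover have "(s, u) \<in> walks_at S (nodes s) v \<times> walks_at S (m - nodes s) (root u)"
    using t su by (auto simp: walks_at_def)
  ultimately show "t \<in> (\<Union>a\<in>{1..<m}. \<Union>w\<in>{w\<in>S. E v w}.
           (\<lambda>(s, t). Jn s t) ` (walks_at S a v \<times> walks_at S (m - a) w))"
    using su by blast
qed (auto simp: walks_at_def)

lemma finite_walks_at: "finite S \<Longrightarrow> finite (walks_at S m v)"
proof (induction m arbitrary: v rule: less_induct)
  case (less m)
  consider "m = 0" | "m = 1" | "m \<ge> 2" by linarith
  then show ?case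
  proof cases
    case 1
    then have "walks_at S m v = {}" unfolding walks_at_def
        by (auto dest: nodes_pos[THEN less_imp_neq, THEN not_sym, THEN notE])
    then show ?thesis by simp
  next
    case 2
    then show ?thesis using walks_at_1 by simp
  next
    case 3
    show ?thesis unfolding walks_at_rec[OF 3]
      using less by (intro finite_UN_I finite_imageI finite_cartesian_product) auto
  qed
qed

lemma W_1: "W S 1 v = of_bool (v \<in> S)"
  by (simp add: W_def walks_at_1 del: One_nat_def)

lemma W_outside: "v \<notin> S \<Longrightarrow> W S m v = 0"
proof -
  assume "v \<notin> S"
  then have "walks_at S m v = {}" using root_in_supp by (fastforce simp: walks_at_def)
  then show ?thesis by (simp add: W_def)
qed

lemma W_rec:
  assumes "m \<ge> 2" "S \<subseteq> V"
  shows "W S m v = (\<Sum>a\<leftarrow>[1..<m]. W S a v * nbr_sum (W S (m - a)) v)"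
proof -
  have fin: "finite S" using assms(2) finite_subset by blast
  let ?X = "\<lambda>a w. (\<lambda>(s, t). Jn s t) ` (walks_at S a v \<times> walks_at S (m - a) w)"
  have "W S m v = card (\<Union>a\<in>{1..<m}. \<Union>w\<in>{w\<in>S. E v w}. ?X a w)"
    unfolding W_def walks_at_rec[OF assms(1)] by simp
  also have "\<dots> = (\<Sum>a\<in>{1..<m}. card (\<Union>w\<in>{w\<in>S. E v w}. ?X a w))"
    using fin by (intro card_UN_disjoint) (auto simp: finite_walks_at, auto simp: walks_at_def)
  also have "\<dots> = (\<Sum>a\<in>{1..<m}. \<Sum>w\<in>{w\<in>S. E v w}. card (?X a w))"
    using fin by (intro sum.cong refl card_UN_disjoint) (auto simp: finite_walks_at,
        auto simp: walks_at_def)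
  also have "\<dots> = (\<Sum>a\<in>{1..<m}. \<Sum>w\<in>{w\<in>S. E v w}. W S a v * W S (m - a) w)"
    by (intro sum.cong refl) (subst card_image, auto simp: inj_on_def W_def card_cartesian_product)
  also have "\<dots> = (\<Sum>a\<in>{1..<m}. W S a v * nbr_sum (W S (m - a)) v)"
  proof (intro sum.cong refl)
    fix a
    \<comment> \<open>Counts vanish outside S, so the sum over neighbours in S equals the sum over
      all listed neighbours, that is, a product of the adjacency matrix with a vector.\<close>
    have "0 < W S (m - a) w \<Longrightarrow> w \<in> S" for w using W_outside[of w S] by (cases "w \<in> S") auto
    then have "(\<Sum>w\<in>{w\<in>S. E v w}. W S (m - a) w) = (\<Sum>w\<in>{w\<in>V. E v w}. W S (m - a) w)"
      using assms(2) by (intro sum.mono_neutral_left) auto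
    then show "(\<Sum>w\<in>{w\<in>S. E v w}. W S a v * W S (m - a) w) = W S a v * nbr_sum (W S (m - a)) v"
      by (simp add: nbr_sum_eq sum_distrib_left[symmetric])
  qed
  finally show ?thesis by (simp add: sum_list_distinct_conv_sum_set)
qed

definition total :: "'a set \<Rightarrow> nat \<Rightarrow> nat" where
  "total S m = (\<Sum>v\<leftarrow>vs. W S m v)"

lemma walks_UN:
  assumes "S \<subseteq> A"
  shows "{t. walk E t \<and> nodes t = m \<and> supp t \<subseteq> S} = (\<Union>v\<in>A. walks_at S m v)"
proof (intro set_eqI iffI)
  fix t assume "t \<in> {t. walk E t \<and> nodes t = m \<and> supp t \<subseteq> S}"
  moreover from this have "root t \<in> A" using assms root_in_supp[of t] by blast
  ultimately show "t \<in> (\<Union>v\<in>A. walks_at S m v)"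
    by (intro UN_I[of "root t"]) (simp_all add: walks_at_def)
qed (auto simp: walks_at_def)

lemma finite_walks:
  assumes "finite S"
  shows "finite {t. walk E t \<and> nodes t = m \<and> supp t \<subseteq> S}"
  unfolding walks_UN[OF order_refl] by (intro finite_UN_I assms finite_walks_at)

lemma total_eq:
  assumes "S \<subseteq> V"
  shows "total S m = card {t. walk E t \<and> nodes t = m \<and> supp t \<subseteq> S}"
proof -
  have "finite S" using assms finite_subset by blast
  then have "card (\<Union>v\<in>V. walks_at S m v) = (\<Sum>v\<in>V. W S m v)"
    unfolding W_def
    by (intro card_UN_disjoint) (auto simp: finite_walks_at, auto simp: walks_at_def)
  then show ?thesis unfolding walks_UN[OF assms]
    by (simp add: total_def sum_list_distinct_conv_sum_set distinct_vs)
qed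

text \<open>Each of the m - 1 joins contributes at most 2n choices for the split and n for the
  neighbour. The bound is crude, but its logarithm is polynomial in n, which is all that the bit
  lengths require.\<close>

lemma W_le:
  assumes "S \<subseteq> V" "1 \<le> m" "m \<le> 2 * n"
  shows "W S m v \<le> (2 * n * n) ^ (m - 1)"
  using assms(2,3)
proof (induction m arbitrary: v rule: less_induct)
  case (less m)
  show ?case
  proof (cases "m = 1")
    case True
    then show ?thesis using W_1 by simp
  next
    case False
    with less.prems have m: "m \<ge> 2" by simp
    let ?D = "2 * n * n"
    have "W S a v * nbr_sum (W S (m - a)) v \<le> n * ?D ^ (m - 2)" if "a \<in> set [1..<m]" for a
    proof -
      have "W S a v \<le> ?D ^ (a - 1)" using that less by auto
      moreover have "nbr_sum (W S (m - a)) v \<le> n * ?D ^ (m - a - 1)"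
        using that less by (intro nbr_sum_le less.IH) auto
      ultimately have "W S a v * nbr_sum (W S (m - a)) v \<le> ?D ^ (a - 1) * (n * ?D ^ (m - a - 1))"
        using mult_le_mono by blast
      also have "\<dots> = n * ?D ^ ((a - 1) + (m - a - 1))" by (simp add: power_add)
      also have "(a - 1) + (m - a - 1) = m - 2" using that by auto
      finally show ?thesis .
    qed
    then have "W S m v \<le> (\<Sum>a\<leftarrow>[1..<m]. n * ?D ^ (m - 2))"
      unfolding W_rec[OF m assms(1)] by (intro sum_list_mono)
    also have "\<dots> = (m - 1) * (n * ?D ^ (m - 2))" by (simp add: sum_list_triv)
    also have "\<dots> \<le> (2 * n) * (n * ?D ^ (m - 2))" using less.prems by (intro mult_le_mono1) simp
    also have "\<dots> = ?D ^ Suc (m - 2)" by simp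
    also have "Suc (m - 2) = m - 1" using m by simp
    finally show ?thesis .
  qed
qed

section \<open>Reachability by iterated neighbour sums\<close>

primrec closure :: "'a set \<Rightarrow> ('a \<Rightarrow> nat) \<Rightarrow> nat \<Rightarrow> 'a \<Rightarrow> nat" where
  "closure S r 0 = r"
| "closure S r (Suc j) = (\<lambda>v. closure S r j v + of_bool (v \<in> S) * nbr_sum (closure S r j) v)"

lemma closure_le:
  assumes "\<And>v. r v \<le> 1"
  shows "closure S r j v \<le> (n + 1) ^ j"
proof (induction j arbitrary: v)
  case (Suc j)
  have "closure S r (Suc j) v \<le> closure S r j v + nbr_sum (closure S r j) v" by simp
  also have "\<dots> \<le> (n + 1) ^ j + n * (n + 1) ^ j" by (intro add_mono Suc nbr_sum_le)
  finally show ?case by simp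
qed (use assms in simp)

text \<open>Only the positivity of a \<open>closure\<close> value carries meaning: sums of naturals
  stand in for disjunctions, so reachability can be computed with the same vector operations as the
  walk counts.\<close>

lemma nbr_sum_pos: "nbr_sum f v > 0 \<longleftrightarrow> (\<exists>w\<in>V. E v w \<and> f w > 0)"
  by (auto simp: nbr_sum_eq sum_nonneg_eq_0_iff[OF _] simp flip: neq0_conv)

lemma closure_subset:
  assumes "r = (\<lambda>v. of_bool (v \<in> X))" "X \<subseteq> S"
  shows "X \<subseteq> {v. closure S r j v > 0} \<and> {v. closure S r j v > 0} \<subseteq> S"
  using assms by (induction j) (auto split: if_splits)

text \<open>The starting set X need not be connected, so the reached set is treated jointly with a
  connected C that contains X. Every vertex added in a round has a neighbour among the earlier ones,
  and the new vertices can be attached singly.\<close>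

lemma closure_connected:
  assumes r: "r = (\<lambda>v. of_bool (v \<in> X))" and C: "cut_connected E C" "X \<subseteq> C" "C \<subseteq> S" and S: "finite S"
      "S \<subseteq> V"
  shows "cut_connected E (C \<union> {v. closure S r j v > 0})"
proof (induction j)
  case 0
  have "C \<union> {v. closure S r 0 v > 0} = C" using r C by auto
  then show ?case using C by simp
next
  case (Suc j)
  let ?R = "\<lambda>j. {v. closure S r j v > 0}"
  have "X \<subseteq> S" using C by auto
  note sub = closure_subset[OF r this]
  let ?N = "?R (Suc j) - (C \<union> ?R j)"
  have nb: "\<exists>x\<in>C \<union> ?R j. E x y" if "y \<in> ?N" for y
  proof -
    have "nbr_sum (closure S r j) y > 0" using that by (auto split: if_splits)
    then obtain w where "E y w" "closure S r j w > 0" by (auto simp: nbr_sum_pos)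
    then show ?thesis using sympD[OF symp_E] by blast
  qed
  have "finite ?N" using sub[of "Suc j"] S(1) by (meson finite_Diff finite_subset)
  then have "cut_connected E (C \<union> ?R j \<union> N)" if "N \<subseteq> ?N" for N
    using that finite_subset[OF that]
  proof (induction N rule: infinite_finite_induct)
    case (insert y N)
    then have IH: "cut_connected E (C \<union> ?R j \<union> N)" by auto
    obtain x where x: "x \<in> C \<union> ?R j" "E x y" using nb[of y] insert.prems by blast
    have "cut_connected E (insert y (C \<union> ?R j \<union> N))"
      by (rule cut_connected_insert[OF symp_E IH _ x(2)]) (use x in auto)
    then show ?case by simp
  qed (use Suc in auto)
  from this[of ?N] have "cut_connected E (C \<union> ?R j \<union> ?N)" by simp
  moreover have "C \<union> ?R j \<union> ?N = C \<union> ?R (Suc j)" by auto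
  ultimately show ?case by (simp del: closure.simps)
qed

lemma closure_covers:
  assumes r: "r = (\<lambda>v. of_bool (v \<in> X))" and T: "cut_connected E T" "T \<subseteq> S" "T \<inter> X \<noteq> {}"
    and S: "S \<subseteq> V"
  shows "T \<subseteq> {v. closure S r n v > 0}"
proof -
  let ?R = "\<lambda>j. {v. closure S r j v > 0}"
  have fin: "finite T" using T(2) S finite_subset by (metis List.finite_set)
  have mono: "?R j \<subseteq> ?R (Suc j)" for j by auto
  \<comment> \<open>The inequality is strict because T meets X before the first round. Each round
    gains a vertex of T until T is covered, so after n rounds the second alternative would need more
    than n vertices.\<close>
  have "T \<subseteq> ?R j \<or> card (T \<inter> ?R j) > j" for j
  proof (induction j)
    case 0
    have "T \<inter> ?R 0 \<noteq> {}" using r T(3) by auto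
    then show ?case using fin by (auto simp: card_gt_0_iff)
  next
    case (Suc j)
    show ?case
    proof (cases "T \<subseteq> ?R j")
      case True
      then show ?thesis using mono by blast
    next
      case False
      then have c: "card (T \<inter> ?R j) > j" using Suc by auto
      then have "T \<inter> ?R j \<noteq> {}" by auto
      then obtain x y where xy: "x \<in> T \<inter> ?R j" "y \<in> T - ?R j" "E x y"
        using False cut_connectedE[OF T(1)] by metis
      have "nbr_sum (closure S r j) y > 0"
        using xy T S sympD[OF symp_E] unfolding nbr_sum_pos by (intro bexI[of _ x]) auto
      then have "y \<in> ?R (Suc j)" using xy T(2) by auto
      then have "insert y (T \<inter> ?R j) \<subseteq> T \<inter> ?R (Suc j)" using xy mono by blast
      then have "card (insert y (T \<inter> ?R j)) \<le> card (T \<inter> ?R (Suc j))"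
        using fin by (intro card_mono) auto
      then show ?thesis using c xy fin by simp
    qed
  qed
  moreover have "card (T \<inter> ?R n) \<le> n"
  proof -
    have "card (T \<inter> ?R n) \<le> card V" using T(2) S by (intro card_mono) auto
    then show ?thesis by (simp add: n_def distinct_card distinct_vs)
  qed
  ultimately show ?thesis by (meson not_less)
qed

end

section \<open>Inclusion-exclusion over a vertex set\<close>

locale colored_graph = listed_graph vs E for vs :: "'a list" and E +
  fixes M :: "'a set"
  assumes M_sub: "M \<subseteq> set vs"
begin

text \<open>The flag s selects the positive or the negative part of the alternating sum over subsets
  of X. Y collects the vertices that a walk may use: a vertex of \<open>D \<inter> M\<close> enters
  only as part of the chosen subset of X, one of \<open>D - M\<close> always, and one outside D
  never.\<close>

primrec mob :: "'a set \<Rightarrow> nat \<Rightarrow> 'a list \<Rightarrow> 'a set \<Rightarrow> bool \<Rightarrow> 'a set \<Rightarrow> nat" where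
  "mob D m [] Y s X = (if s then total Y m else 0)"
| "mob D m (v # l) Y s X =
     (if v \<in> D \<inter> M then
        (if v \<in> X then mob D m l (insert v Y) s X + mob D m l Y (\<not> s) X else mob D m l Y s X)
      else mob D m l (Y \<union> ({v} \<inter> D)) s X)"

lemma mob_cong: "X \<inter> set l = X' \<inter> set l \<Longrightarrow> mob D m l Y s X = mob D m l Y s X'"
proof (induction l arbitrary: Y s)
  case (Cons v l)
  then have "X \<inter> set l = X' \<inter> set l" "v \<in> X \<longleftrightarrow> v \<in> X'" by auto
  with Cons.IH show ?case by simp
qed simp

lemma mob_le:
  assumes "\<And>Y. Y \<subseteq> V \<Longrightarrow> total Y m \<le> H"
  shows "set l \<subseteq> V \<Longrightarrow> Y \<subseteq> V \<Longrightarrow> mob D m l Y s X \<le> 2 ^ length l * H"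
proof (induction l arbitrary: Y s)
  case Nil
  then show ?case using assms by simp
next
  case (Cons v l)
  have "mob D m l Y s X \<le> 2 ^ length l * H" "mob D m l Y (\<not>s) X \<le> 2 ^ length l * H" 
    "mob D m l (insert v Y) s X \<le> 2 ^ length l * H" "mob D m l (Y \<union> ({v} \<inter> D)) s X \<le> 2 ^ length l * H"
    using Cons.prems by (auto intro!: Cons.IH)
  then show ?case by simp
qed

text \<open>Vertices in Y are allowed, those in X required. For v in X, the call with
  \<open>insert v Y\<close> counts the walks that may use v, and the call with flipped sign
  subtracts those that avoid it; what remains are the walks that visit v.\<close>

lemma mob_diff:
  assumes "distinct l" "set l \<subseteq> V" "Y \<subseteq> V" "Y \<inter> set l = {}" "X \<subseteq> D \<inter> M \<inter> set l"
  shows "int (mob D m l Y True X) - int (mob D m l Y False X) =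
    int (card {t. walk E t \<and> nodes t = m \<and> supp t \<subseteq> Y \<union> X \<union> (D - M) \<inter> set l \<and> X \<subseteq> supp t})"
  using assms
proof (induction l arbitrary: Y X)
  case Nil
  then show ?case by (simp add: total_eq)
next
  case (Cons v l)
  let ?N = "\<lambda>l Y X. {t. walk E t \<and> nodes t = m \<and> supp t \<subseteq> Y \<union> X \<union> (D - M) \<inter> set l \<and> X \<subseteq> supp t}"
  have l: "distinct l" "set l \<subseteq> V" "v \<in> V" "v \<notin> set l" using Cons.prems by auto
  show ?case
  proof (cases "v \<in> D \<inter> M")
    case False
    have "int (mob D m l (Y \<union> ({v} \<inter> D)) True X) - int (mob D m l (Y \<union> ({v} \<inter> D)) False X) =
       int (card (?N l (Y \<union> ({v} \<inter> D)) X))"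
      using Cons.prems False by (intro Cons.IH) auto
    moreover have "Y \<union> ({v} \<inter> D) \<union> X \<union> (D - M) \<inter> set l = Y \<union> X \<union> (D - M) \<inter> set (v # l)"
      using False by auto
    moreover have "mob D m (v # l) Y s X = mob D m l (Y \<union> ({v} \<inter> D)) s X" for s
      unfolding mob.simps(2) using False by (simp only: if_False)
    ultimately show ?thesis by presburger
  next
    case True
    show ?thesis
    proof (cases "v \<in> X")
      case vX: False
      have "int (mob D m l Y True X) - int (mob D m l Y False X) = int (card (?N l Y X))"
        using Cons.prems vX by (intro Cons.IH) auto
      moreover have "(D - M) \<inter> set (v # l) = (D - M) \<inter> set l" using True by auto
      moreover have "mob D m (v # l) Y s X = mob D m l Y s X" for s
        unfolding mob.simps(2) using True vX by (simp only: if_True if_False)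
      ultimately show ?thesis by (simp only:)
    next
      case vX: True
      let ?X = "X - {v}"
      \<comment> \<open>Once v is processed, X is consulted only on the rest of the list; dropping v
        makes the set a subset of that rest, as the induction hypothesis demands.\<close>
      have c: "mob D m l Z s X = mob D m l Z s ?X" for Z s
        using l by (intro mob_cong) auto
      have 1: "int (mob D m l (insert v Y) True ?X) - int (mob D m l (insert v Y) False ?X) =
          int (card (?N l (insert v Y) ?X))"
        using Cons.prems by (intro Cons.IH) auto
      have 2: "int (mob D m l Y True ?X) - int (mob D m l Y False ?X) = int (card (?N l Y ?X))"
        using Cons.prems by (intro Cons.IH) auto
      have eq: "?N l (insert v Y) ?X = ?N (v # l) Y X \<union> ?N l Y ?X" 
        using vX True by auto
      have disj: "?N (v # l) Y X \<inter> ?N l Y ?X = {}"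
        using vX Cons.prems by auto
      have "Y \<union> X \<union> (D - M) \<inter> set (v # l) \<subseteq> V" "Y \<union> ?X \<union> (D - M) \<inter> set l \<subseteq> V"
        using Cons.prems by auto
      then have fS: "finite (Y \<union> X \<union> (D - M) \<inter> set (v # l))" "finite (Y \<union> ?X \<union> (D - M) \<inter> set l)"
        using finite_subset by blast+
      have fin': "finite {t. walk E t \<and> nodes t = m \<and> supp t \<subseteq> S \<and> A \<subseteq> supp t}"
        if "finite S" for S A
        using finite_walks[OF that, of m] by (rule rev_finite_subset) auto
      note fin = fin'[OF fS(1), of X] fin'[OF fS(2), of ?X]
      have "card (?N l (insert v Y) ?X) = card (?N (v # l) Y X) + card (?N l Y ?X)"
        unfolding eq by (rule card_Un_disjoint[OF fin disj])
      with 1 2 show ?thesis using True vX by (simp add: c)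
    qed
  qed
qed

text \<open>The difference is a cardinality, so existence of a walk is already visible from the two
  parts being unequal; no subtraction or comparison of sizes is ever carried out.\<close>

lemma mob_exact:
  assumes "D \<subseteq> V" "X \<subseteq> D \<inter> M"
  shows "mob D m vs {} True X \<noteq> mob D m vs {} False X \<longleftrightarrow>
    (\<exists>t. walk E t \<and> nodes t = m \<and> supp t \<subseteq> X \<union> (D - M) \<and> X \<subseteq> supp t)"
proof -
  let ?A = "{t. walk E t \<and> nodes t = m \<and> supp t \<subseteq> X \<union> (D - M) \<and> X \<subseteq> supp t}"
  have "(D - M) \<inter> V = D - M" using assms by auto
  then have card: "int (mob D m vs {} True X) - int (mob D m vs {} False X) = int (card ?A)"
    using mob_diff[of vs "{}" X D m] assms distinct_vs by auto
  have "finite ?A"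
  proof -
    have "finite (X \<union> (D - M))" using assms finite_subset[of _ V] by auto
    from finite_walks[OF this, of m] show ?thesis by (rule rev_finite_subset) auto
  qed
  then have "card ?A = 0 \<longleftrightarrow> ?A = {}" by (simp only: card_0_eq)
  moreover have "mob D m vs {} True X = mob D m vs {} False X \<longleftrightarrow> card ?A = 0"
    using card by linarith
  ultimately show ?thesis by (simp only: ex_in_conv[symmetric] mem_Collect_eq not_not)
qed

section \<open>Criterion for balanced connected sets\<close>

definition solution :: "'a set \<Rightarrow> nat \<Rightarrow> 'a set \<Rightarrow> bool" where
  "solution D k T \<longleftrightarrow> T \<subseteq> D \<and> (T = {} \<or> cut_connected E T) \<and> card (T \<inter> M) = k \<and> card (T - M) = k"

definition solvable :: "'a set \<Rightarrow> nat \<Rightarrow> bool" where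
  "solvable D k \<longleftrightarrow> (\<exists>T. solution D k T)"

definition reach :: "'a set \<Rightarrow> 'a set \<Rightarrow> 'a \<Rightarrow> nat" where
  "reach D X = closure D (\<lambda>v. of_bool (v \<in> X)) n"

definition accept :: "'a set \<Rightarrow> nat \<Rightarrow> 'a set \<Rightarrow> bool" where
  "accept D k X \<longleftrightarrow> card X = k \<and> mob D (2 * k) vs {} True X \<noteq> mob D (2 * k) vs {} False X \<and>
     k \<le> card {v \<in> V. reach (X \<union> (D - M)) X v > 0 \<and> v \<notin> M}"

text \<open>Forwards, \<open>X = T \<inter> M\<close>: a spanning tree of T supplies the walk, and T
  itself is reachable from X. Backwards, the support of the walk has at most 2k vertices, its union
  U with the reached vertices has at least 2k, and a connected set of exactly 2k vertices in between
  has k vertices in M and hence k outside.\<close>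

lemma solvable_iff:
  assumes "D \<subseteq> V" "k > 0"
  shows "solvable D k \<longleftrightarrow> (\<exists>X \<subseteq> D \<inter> M. accept D k X)"
proof
  assume "solvable D k"
  then obtain T where T: "T \<subseteq> D" "cut_connected E T" "card (T \<inter> M) = k" "card (T - M) = k"
    using assms(2) by (auto simp: solvable_def solution_def)
  define X where "X = T \<inter> M"
  have fin: "finite T" using T assms finite_subset[of _ V] by auto
  have XD: "X \<subseteq> D \<inter> M" using T by (auto simp: X_def)
  have TX: "T \<subseteq> X \<union> (D - M)" using T by (auto simp: X_def)
  have "card T = 2 * k" using card_Int_Diff[OF fin, of M] T by simp
  obtain t where "walk E t" "nodes t = card T" "supp t = T"
    using cut_connected_imp_walk[OF T(2) fin] by blast
  then have "mob D (2 * k) vs {} True X \<noteq> mob D (2 * k) vs {} False X"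
    unfolding mob_exact[OF assms(1) XD] using \<open>card T = 2 * k\<close> TX
        by (intro exI[of _ t]) (auto simp: X_def)
  moreover have "k \<le> card {v \<in> V. reach (X \<union> (D - M)) X v > 0 \<and> v \<notin> M}"
  proof -
    have "T \<inter> X \<noteq> {}" using T(3) assms(2) by (auto simp: X_def card_gt_0_iff)
    then have "T \<subseteq> {v. reach (X \<union> (D - M)) X v > 0}"
      unfolding reach_def using XD assms(1) by (intro closure_covers[OF refl T(2) TX]) auto
    then have "T - M \<subseteq> {v \<in> V. reach (X \<union> (D - M)) X v > 0 \<and> v \<notin> M}" using T assms by auto
    then have "card (T - M) \<le> card {v \<in> V. reach (X \<union> (D - M)) X v > 0 \<and> v \<notin> M}"
      by (intro card_mono) auto
    then show ?thesis using T by simp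
  qed
  ultimately have "accept D k X" using T by (simp add: accept_def X_def)
  then show "\<exists>X \<subseteq> D \<inter> M. accept D k X" using XD by blast
next
  assume "\<exists>X \<subseteq> D \<inter> M. accept D k X"
  then obtain X where X: "X \<subseteq> D \<inter> M" "card X = k" 
    "mob D (2 * k) vs {} True X \<noteq> mob D (2 * k) vs {} False X"
    "k \<le> card {v \<in> V. reach (X \<union> (D - M)) X v > 0 \<and> v \<notin> M}"
    by (auto simp: accept_def)
  let ?S = "X \<union> (D - M)"
  have S: "?S \<subseteq> V" "finite ?S" using X(1) assms(1) finite_subset[of _ V] by auto
  obtain t where t: "walk E t" "nodes t = 2 * k" "supp t \<subseteq> ?S" "X \<subseteq> supp t"
    using X(3) mob_exact[OF assms(1) X(1)] by auto
  let ?R = "{v. reach ?S X v > 0}"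
  \<comment> \<open>Including the support makes U connected by \<open>closure_connected\<close> and
    a superset of the support, as the interpolation requires.\<close>
  define U where "U = supp t \<union> ?R"
  have ct: "cut_connected E (supp t)" using cut_connected_supp[OF symp_E t(1)] .
  have RS: "X \<subseteq> ?R" "?R \<subseteq> ?S" using closure_subset[OF refl, of X ?S n] by (auto simp: reach_def)
  have cU: "cut_connected E U"
    using closure_connected[OF refl ct t(4,3) S(2,1)] by (simp add: U_def reach_def)
  have US: "U \<subseteq> ?S" using t RS by (auto simp: U_def)
  then have finU: "finite U" using S finite_subset by blast
  \<comment> \<open>This keeps the minority part constant while the set grows.\<close>
  have UM: "A \<inter> M = X" if "X \<subseteq> A" "A \<subseteq> ?S" for A using that X(1) by auto
  have "k \<le> card (U - M)"
  proof -
    have "{v \<in> V. reach ?S X v > 0 \<and> v \<notin> M} \<subseteq> U - M" by (auto simp: U_def)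
    then have "card {v \<in> V. reach ?S X v > 0 \<and> v \<notin> M} \<le> card (U - M)" using finU by (intro card_mono) auto
    then show ?thesis using X(4) by simp
  qed
  moreover have "card (U \<inter> M) = k" using UM[of U] US t X by (simp add: U_def le_supI1)
  ultimately have "2 * k \<le> card U" using card_Int_Diff[OF finU, of M] by simp
  moreover have "card (supp t) \<le> 2 * k" using card_supp_le[of t] t by simp
  ultimately obtain T where T: "supp t \<subseteq> T" "T \<subseteq> U" "cut_connected E T" "card T = 2 * k"
    using cut_connected_interpolate[OF symp_E ct cU _ finU] by (auto simp: U_def)
  have "T \<inter> M = X" using UM[of T] T t US by auto
  moreover have "finite T" using T finU finite_subset by blast
  ultimately have "card (T - M) = k" using card_Int_Diff[of T M] T(4) X(2) by simp
  with \<open>T \<inter> M = X\<close> X(1,2) T US show "solvable D k"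
    unfolding solvable_def solution_def by (intro exI[of _ T]) auto
qed

lemma solvable_mono: "solvable D k \<Longrightarrow> D \<subseteq> D' \<Longrightarrow> solvable D' k"
  unfolding solvable_def solution_def by blast

lemma solvable_0: "solvable D 0"
  unfolding solvable_def solution_def by (intro exI[of _ "{}"]) auto

lemma solvable_le: "D \<subseteq> V \<Longrightarrow> solvable D k \<Longrightarrow> k \<le> n"
proof -
  assume "D \<subseteq> V" "solvable D k"
  then obtain T where "T \<subseteq> V" "card (T \<inter> M) = k" by (auto simp: solvable_def solution_def)
  moreover have "card (T \<inter> M) \<le> card V" using \<open>T \<subseteq> V\<close> by (intro card_mono) auto
  ultimately show ?thesis by (simp add: n_def distinct_card distinct_vs)
qed

section \<open>From decision to construction\<close>

fun prune :: "nat \<Rightarrow> 'a set \<Rightarrow> 'a list \<Rightarrow> 'a set" where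
  "prune k D [] = D"
| "prune k D (v # l) = (if solvable (D - {v}) k then prune k (D - {v}) l else prune k D l)"

lemma prune_subset: "prune k D l \<subseteq> D"
  by (induction l arbitrary: D) (auto split: if_splits)

lemma prune_outside: "v \<notin> set l \<Longrightarrow> v \<in> prune k D l \<longleftrightarrow> v \<in> D"
  by (induction l arbitrary: D) auto

lemma prune_solvable: "solvable D k \<Longrightarrow> solvable (prune k D l) k"
  by (induction l arbitrary: D) auto

text \<open>One pass suffices: a vertex that could not be deleted from the current set cannot be
  deleted from the smaller final set either, by \<open>solvable_mono\<close>.\<close>

lemma prune_minimal: "v \<in> set l \<Longrightarrow> v \<in> prune k D l \<Longrightarrow> \<not> solvable (prune k D l - {v}) k"
proof (induction l arbitrary: D)
  case (Cons w l)
  have "\<not> solvable (prune k D l - {w}) k" if "\<not> solvable (D - {w}) k"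
    using that solvable_mono[of "prune k D l - {w}" k "D - {w}"] prune_subset[of k D l] by blast
  with Cons show ?case 
    using prune_subset[of k "D - {w}" l] by (cases "v = w") (auto split: if_splits)
qed simp

text \<open>The final set contains a solution; a vertex outside that solution could have been
  deleted, so the solution is the whole set.\<close>

lemma prune_solution:
  assumes "solvable D k" "D \<subseteq> V"
  shows "solution D k (prune k D vs)"
proof -
  obtain T where T: "solution (prune k D vs) k T"
    using prune_solvable[OF assms(1)] by (auto simp: solvable_def)
  have "T = prune k D vs"
  proof (rule ccontr)
    assume "T \<noteq> prune k D vs"
    then obtain v where v: "v \<in> prune k D vs" "v \<notin> T" using T by (auto simp: solution_def)
    then have "solution (prune k D vs - {v}) k T" using T by (auto simp: solution_def)
    moreover have "v \<in> V" using v prune_subset assms(2) by blast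
    ultimately show False using prune_minimal[of v vs k D] v by (auto simp: solvable_def)
  qed
  then show ?thesis using T prune_subset[of k D vs] by (auto simp: solution_def)
qed

end

section \<open>Numbers, vectors and the program\<close>

text \<open>Binary with the least significant bit first and no leading zeros. Hence zero is
  \<open>Atom\<close>, \<open>EIf\<close> tests for it, and equality of numbers is equality of
  trees.\<close>

fun enc :: "nat \<Rightarrow> sexp" where
  "enc m = (if m = 0 then Atom else Pair (sexp_of_bool (odd m)) (enc (m div 2)))"

declare enc.simps [simp del]

lemma enc_0 [simp]: "enc 0 = Atom"
  by (simp add: enc.simps)

lemma enc_1 [simp]: "enc (Suc 0) = Pair (Pair Atom Atom) Atom"
  by (simp add: enc.simps[of "Suc 0"])

lemma enc_eq_Atom [simp]: "enc m = Atom \<longleftrightarrow> m = 0"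
  by (simp add: enc.simps)

lemma sexp_of_bool_eq_Atom [simp]: "sexp_of_bool b = Atom \<longleftrightarrow> \<not> b"
  by (cases b) auto

lemma hd_enc [simp]: "hd_sexp (enc m) = sexp_of_bool (odd m)"
  by (cases "m = 0") (simp_all add: enc.simps[of m])

lemma tl_enc [simp]: "tl_sexp (enc m) = enc (m div 2)"
  by (cases "m = 0") (simp_all add: enc.simps[of m])

lemma enc_inject [simp]: "enc a = enc b \<longleftrightarrow> a = b"
proof
  assume "enc a = enc b"
  then show "a = b"
  proof (induction a arbitrary: b rule: less_induct)
    case (less a)
    show ?case
    proof (cases "a = 0")
      case True
      then show ?thesis using less.prems by (metis enc_0 enc_eq_Atom)
    next
      case False
      have "sexp_of_bool (odd a) = sexp_of_bool (odd b)" "enc (a div 2) = enc (b div 2)"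
        using less.prems hd_enc tl_enc by metis+
      then have "odd a \<longleftrightarrow> odd b" "a div 2 = b div 2"
        using less.IH[of "a div 2" "b div 2"] False
            by (auto split: if_splits) (metis sexp_of_bool_eq_Atom)+
      then show ?thesis by presburger
    qed
  qed
qed simp

lemma size_enc_le: "a < 2 ^ L \<Longrightarrow> size (enc a) \<le> 3 * L"
proof (induction L arbitrary: a)
  case (Suc L)
  have "size (sexp_of_bool b) \<le> 1" for b by (cases b) auto
  then have "size (enc a) \<le> 2 + size (enc (a div 2))"
    by (cases "a = 0") (simp_all add: enc.simps[of a])
  moreover have "size (enc (a div 2)) \<le> 3 * L" using Suc by (intro Suc.IH) auto
  ultimately show ?case by simp
qed simp

definition evec :: "'a list \<Rightarrow> ('a \<Rightarrow> nat) \<Rightarrow> sexp" where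
  "evec l f = sexp_of_list (map (\<lambda>v. enc (f v)) l)"

lemma evec_simps [simp]:
  "evec [] f = Atom" "evec (v # l) f = Pair (enc (f v)) (evec l f)"
  by (simp_all add: evec_def)

lemma evec_eq_Atom [simp]: "evec l f = Atom \<longleftrightarrow> l = []"
  by (cases l) auto

lemma evec_cong: "(\<And>v. v \<in> set l \<Longrightarrow> f v = g v) \<Longrightarrow> evec l f = evec l g"
  by (simp add: evec_def cong: map_cong)

lemma sexp_of_list_eq_Atom [simp]: "sexp_of_list xs = Atom \<longleftrightarrow> xs = []"
  by (cases xs) auto

lemma tl_sexp_of_list [simp]: "tl_sexp (sexp_of_list xs) = sexp_of_list (tl xs)"
  by (cases xs) auto

text \<open>
  \<open>f_call\<close> calls the function with body \<open>f_body\<close>. Unary numbers are lists of which only the length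
  matters, sets of vertices are 0/1 vectors of numbers (\<open>ONE\<close> is the number 1). A vertex set that is
  built up vertex by vertex is accumulated in reverse, hence the calls of \<open>rev\<close>. The functions \<open>sub\<close>,
  \<open>build\<close> and \<open>scan\<close> subtract, construct and search the tree of the inclusion-exclusion sums, which
  branches at the vertices of the minority; \<open>half\<close> returns a nonempty list iff at most half of the
  vertices are blue.
\<close>

abbreviation "TT \<equiv> EPair EAtom EAtom"
abbreviation "ONE \<equiv> EPair TT EAtom"
abbreviation "add_call \<equiv> ECall 1"
abbreviation "mul_call \<equiv> ECall 2"
abbreviation "vadd_call \<equiv> ECall 3"
abbreviation "vmul_call \<equiv> ECall 4"
abbreviation "dot_call \<equiv> ECall 5"
abbreviation "matvec_call \<equiv> ECall 6"
abbreviation "conv_call \<equiv> ECall 7"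
abbreviation "rev_call \<equiv> ECall 8"
abbreviation "walks_call \<equiv> ECall 9"
abbreviation "total_call \<equiv> ECall 10"
abbreviation "sub_call \<equiv> ECall 11"
abbreviation "build_call \<equiv> ECall 12"
abbreviation "eq_call \<equiv> ECall 13"
abbreviation "scan_call \<equiv> ECall 14"
abbreviation "reach_call \<equiv> ECall 15"
abbreviation "closure_call \<equiv> ECall 16"
abbreviation "atleast_call \<equiv> ECall 17"
abbreviation "decide_call \<equiv> ECall 18"
abbreviation "maximum_call \<equiv> ECall 19"
abbreviation "prune_call \<equiv> ECall 20"
abbreviation "half_call \<equiv> ECall 21"
abbreviation "minor_call \<equiv> ECall 22"
abbreviation "X0 \<equiv> EVar 0"
abbreviation "X1 \<equiv> EVar 1"
abbreviation "X2 \<equiv> EVar 2"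
abbreviation "X3 \<equiv> EVar 3"
abbreviation "X4 \<equiv> EVar 4"
abbreviation "X5 \<equiv> EVar 5"
abbreviation "X6 \<equiv> EVar 6"
abbreviation "X7 \<equiv> EVar 7"

text \<open>The instance is a list of n rows and therefore doubles as the unary number n, from which
  the search for the largest k starts. The full vertex set is obtained as the sum of the minority
  vector and its complement.\<close>

definition "main_body =
  ELet (half_call [X0, EPair EAtom X0])
    (ELet (minor_call [X1, X0])
      (ELet (vadd_call [X0, minor_call [X2, EIf X1 EAtom TT]])
        (prune_call [X3, X1, EAtom, X0, maximum_call [X3, X1, X0, X3]])))"

text \<open>The arguments are a carry bit and two numbers. The nested conditional in the guard is a
  disjunction: the recursion stops only when all three are zero, which yields a final carry but no
  leading zeros.\<close>

definition "add_body =
  EIf (EIf X0 X0 (EIf X1 X1 X2))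
    (EPair
      (EIf X0 (EIf (EHd X1) (EHd X2) (EIf (EHd X2) EAtom TT))
        (EIf (EHd X1) (EIf (EHd X2) EAtom TT) (EHd X2)))
      (add_call [EIf X0 (EIf (EHd X1) TT (EHd X2)) (EIf (EHd X1) (EHd X2) EAtom), ETl X1, ETl X2]))
    EAtom"

text \<open>Horner's scheme on the bits of the first factor. Doubling puts a zero bit in front,
  except for zero itself, whose code must stay \<open>Atom\<close>.\<close>

definition "mul_body =
  EIf X0
    (ELet (mul_call [ETl X0, X1])
      (ELet (EIf X0 (EPair EAtom X0) EAtom)
        (EIf (EHd X2) (add_call [EAtom, X3, X0]) X0)))
    EAtom"

text \<open>Returning the second argument when the first is \<open>Atom\<close> lets
  \<open>Atom\<close> serve as the empty sum of vectors, whatever their length;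
  \<open>conv_body\<close> starts from it.\<close>

definition "vadd_body =
  EIf X0 (EPair (add_call [EAtom, EHd X0, EHd X1]) (vadd_call [ETl X0, ETl X1])) X1"

definition "vmul_body =
  EIf X0 (EPair (mul_call [EHd X0, EHd X1]) (vmul_call [ETl X0, ETl X1])) EAtom"

text \<open>The first list is only a mask, so this is an inner product with a 0/1 vector and needs
  no multiplication.\<close>

definition "dot_body =
  EIf X0
    (ELet (dot_call [ETl X0, ETl X1]) (EIf (EHd X1) (add_call [EAtom, EHd X2, X0]) X0))
    EAtom"

definition "matvec_body =
  EIf X0 (EPair (dot_call [ETl (EHd X0), X1]) (matvec_call [ETl X0, X1])) EAtom"

definition "conv_body =
  EIf X0 (vadd_call [conv_call [ETl X0, ETl X1], vmul_call [EHd X0, EHd X1]]) EAtom"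

definition "rev_body = EIf X0 (rev_call [ETl X0, EPair (EHd X0) X1]) X1"

text \<open>The third and fourth arguments are the histories of the walk counts and of their
  neighbour sums, both newest first. Reversing one of them aligns sizes that add up to the next one,
  so the recurrence becomes an elementwise product and sum. The second argument counts the remaining
  rounds.\<close>

definition "walks_body =
  EIf X1
    (ELet (conv_call [rev_call [X2, EAtom], X3])
      (walks_call [X1, ETl X2, EPair X0 X3, EPair (matvec_call [X1, X0]) X4]))
    (EHd X2)"

definition "total_body =
  ELet (walks_call [X0, X2, EPair X1 EAtom, EPair (matvec_call [X0, X1]) EAtom])
    (dot_call [X0, X0])"

text \<open>At the leaves, (p - q) - (p' - q') is represented by the pair (p + q', q + p').\<close>

definition "sub_body =
  EIf X0
    (EIf (EHd X0)
      (EPair (sub_call [ETl X0, EHd X1, EHd X2]) (sub_call [ETl X0, ETl X1, ETl X2]))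
      (sub_call [ETl X0, X1, X2]))
    (EPair (add_call [EAtom, EHd X1, ETl X2]) (add_call [EAtom, ETl X1, EHd X2]))"

text \<open>One level of the Moebius transform per branching vertex: the subtree without v is
  computed once, kept as the left child and also subtracted from the subtree with v. A leaf starts
  as the pair of a walk count and zero; the fourth argument is the set of allowed vertices,
  reversed.\<close>

definition "build_body =
  EIf X1
    (EIf (EHd X1)
      (ELet (build_call [X0, ETl X1, ETl X2, EPair EAtom X3, X4])
        (EPair X0
          (sub_call [ETl X2, build_call [X1, ETl X2, ETl X3, EPair ONE X4, X5], X0])))
      (build_call [X0, ETl X1, ETl X2, EPair (EHd X2) X3, X4]))
    (EPair (total_call [X0, rev_call [X3, EAtom], X4]) EAtom)"

definition "eq_body =
  EIf X0
    (EIf X1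
      (EIf (eq_call [EHd X0, EHd X1]) (eq_call [ETl X0, ETl X1]) EAtom)
      EAtom)
    (EIf X1 EAtom TT)"

text \<open>The tree is descended along the vertex list. \<open>X6\<close> is a unary budget of
  branching vertices still to be chosen and must be used up at the leaf, which enforces
  \<open>card X = k\<close>; \<open>X7\<close> retains the full k for the size test.\<close>

definition "scan_body =
  EIf X2
    (EIf (EHd X2)
      (EIf (scan_call [X0, X1, ETl X2, ETl X3, EHd X4, EPair EAtom X5, X6, X7])
        TT
        (EIf X6
          (scan_call [X0, X1, ETl X2, ETl X3, ETl X4, EPair ONE X5, ETl X6, X7])
          EAtom))
      (scan_call [X0, X1, ETl X2, ETl X3, X4, EPair (EHd X3) X5, X6, X7]))
    (EIf X6
      EAtom
      (EIf (eq_call [EHd X4, ETl X4]) EAtom (reach_call [X0, X1, rev_call [X5, EAtom], X7])))"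

text \<open>The product of the two masks is the starting set, and the instance serves once more as
  unary n, here the number of rounds.\<close>

definition "reach_body =
  atleast_call [X1, closure_call [X0, X2, X0, vmul_call [X2, X1]], X3]"

definition "closure_body =
  EIf X2
    (closure_call [X0, X1, ETl X2, vadd_call [X3, vmul_call [X1, matvec_call [X0, X3]]]])
    X3"

definition "atleast_body =
  EIf X0
    (atleast_call [ETl X0, ETl X1, EIf (EHd X1) (EIf (EHd X0) X2 (ETl X2)) X2])
    (EIf X2 EAtom TT)"

text \<open>The list made from \<open>X4\<close> and its tail is the unary number 2k - 1: a walk
  count for one node is the starting point, so 2k nodes take 2k - 1 further rounds. For k = 0 the
  empty set is a solution.\<close>

definition "decide_body =
  EIf X3
    (ELet (vmul_call [X2, X1])
      (scan_call [X1, X0, X0, X3, build_call [X1, X0, X3, EAtom, rev_call [X4, ETl X4]],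
        EAtom, X4, X4]))
    TT"

definition "maximum_body =
  EIf (decide_call [X0, X1, X2, X3]) X3 (maximum_call [X0, X1, X2, ETl X3])"

text \<open>The third argument holds the survivors so far in reverse, the fourth the untouched
  vertices. Reversing the former onto the latter, with the current entry replaced by zero, gives the
  mask of the set with the current vertex deleted.\<close>

definition "prune_body =
  EIf X3
    (EIf (decide_call [X0, X1, rev_call [X2, EPair EAtom (ETl X3)], X4])
      (EPair EAtom (prune_call [X0, X1, EPair EAtom X2, ETl X3, X4]))
      (EPair TT (prune_call [X0, X1, EPair ONE X2, ETl X3, X4])))
    EAtom"

definition "half_body =
  EIf X0 (half_call [ETl X0, EIf (EHd (EHd X0)) (ETl (ETl X1)) X1]) X1"

definition "minor_body =
  EIf X0
    (EPair (EIf (EHd (EHd X0)) (EIf X1 ONE EAtom) (EIf X1 EAtom ONE)) (minor_call [ETl X0, X1]))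
    EAtom"

definition bcs_program :: program where
  "bcs_program =
     [main_body, add_body, mul_body, vadd_body, vmul_body, dot_body, matvec_body, conv_body,
      rev_body, walks_body, total_body, sub_body, build_body, eq_body, scan_body, reach_body,
      closure_body, atleast_body, decide_body, maximum_body, prune_body, half_body, minor_body]"

section \<open>Weakest preconditions with running times\<close>

definition wp :: "sexp list \<Rightarrow> expr \<Rightarrow> (sexp \<Rightarrow> nat \<Rightarrow> bool) \<Rightarrow> bool" where
  "wp \<rho> e K \<longleftrightarrow> (\<exists>v t. eval bcs_program \<rho> e v t \<and> K v t)"

definition wps :: "sexp list \<Rightarrow> expr list \<Rightarrow> (sexp list \<Rightarrow> nat \<Rightarrow> bool) \<Rightarrow> bool" where
  "wps \<rho> es K \<longleftrightarrow> (\<exists>vs t. evals bcs_program \<rho> es vs t \<and> K vs t)"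

definition wpc :: "nat \<Rightarrow> sexp list \<Rightarrow> (sexp \<Rightarrow> nat \<Rightarrow> bool) \<Rightarrow> bool" where
  "wpc f xs K \<longleftrightarrow> f < length bcs_program \<and> wp xs (bcs_program ! f) K"

definition call :: "nat \<Rightarrow> sexp list \<Rightarrow> sexp \<Rightarrow> nat \<Rightarrow> bool" where
  "call f xs v T \<longleftrightarrow> wpc f xs (\<lambda>y t. y = v \<and> t \<le> T)"

definition time_of :: "nat \<Rightarrow> sexp list \<Rightarrow> nat" where
  "time_of f xs = (THE t. \<exists>v. eval bcs_program xs (bcs_program ! f) v t)"

text \<open>By determinism a specification of a call becomes an equation that rewrites the weakest
  precondition of that call. The exact time, known only to be bounded, gets the name
  \<open>time_of\<close>. With these equations and \<open>wp_simps\<close> a function body is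
  executed symbolically, and linear arithmetic adds up the time.\<close>

lemma callD:
  assumes "call f xs v T"
  shows "(\<forall>K. wpc f xs K \<longleftrightarrow> K v (time_of f xs)) \<and> time_of f xs \<le> T"
proof -
  from assms obtain t where f: "f < length bcs_program"
    and t: "t \<le> T" "eval bcs_program xs (bcs_program ! f) v t"
    by (auto simp: call_def wpc_def wp_def)
  have "time_of f xs = t"
    unfolding time_of_def using t(2) eval_deterministic[OF t(2)] by (intro the_equality) blast+
  moreover have "wpc f xs K \<longleftrightarrow> K v t" for K
    unfolding wpc_def wp_def using f t(2) eval_deterministic[OF t(2)] by metis
  ultimately show ?thesis using t(1) by simp
qed

lemma wp_EVar: "wp \<rho> (EVar i) K \<longleftrightarrow> i < length \<rho> \<and> K (\<rho> ! i) 1"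
  unfolding wp_def wps_def wpc_def by (subst eval.simps) (auto; blast)

lemma wp_EAtom: "wp \<rho> EAtom K \<longleftrightarrow> K Atom 1"
  unfolding wp_def wps_def wpc_def by (subst eval.simps) (auto; blast)

lemma wp_EPair:
  "wp \<rho> (EPair a b) K \<longleftrightarrow> wp \<rho> a (\<lambda>x s. wp \<rho> b (\<lambda>y t. K (Pair x y) (s + t + 1)))"
  unfolding wp_def wps_def wpc_def by (subst eval.simps) (auto; blast)

lemma wp_EHd: "wp \<rho> (EHd a) K \<longleftrightarrow> wp \<rho> a (\<lambda>x s. K (hd_sexp x) (s + 1))"
  unfolding wp_def wps_def wpc_def by (subst eval.simps) (auto; blast)

lemma wp_ETl: "wp \<rho> (ETl a) K \<longleftrightarrow> wp \<rho> a (\<lambda>x s. K (tl_sexp x) (s + 1))"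
  unfolding wp_def wps_def wpc_def by (subst eval.simps) (auto; blast)

lemma wp_EIf:
  "wp \<rho> (EIf c a b) K \<longleftrightarrow>
     wp \<rho> c (\<lambda>x s. if x = Atom then wp \<rho> b (\<lambda>y t. K y (s + t + 1)) else wp \<rho> a (\<lambda>y t. K y (s + t + 1)))"
  unfolding wp_def by (subst eval.simps) (auto; blast)

lemma wp_ELet:
  "wp \<rho> (ELet a b) K \<longleftrightarrow> wp \<rho> a (\<lambda>x s. wp (x # \<rho>) b (\<lambda>y t. K y (s + t + 1)))"
  unfolding wp_def wps_def wpc_def by (subst eval.simps) (auto; blast)

lemma wp_ECall:
  "wp \<rho> (ECall f as) K \<longleftrightarrow> wps \<rho> as (\<lambda>xs s. wpc f xs (\<lambda>y t. K y (s + t + 1)))"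
  unfolding wp_def wps_def wpc_def by (subst eval.simps) (auto; blast)

lemma wps_Nil: "wps \<rho> [] K \<longleftrightarrow> K [] 0"
  unfolding wp_def wps_def wpc_def by (subst evals.simps) (auto; blast)

lemma wps_Cons:
  "wps \<rho> (a # as) K \<longleftrightarrow> wp \<rho> a (\<lambda>x s. wps \<rho> as (\<lambda>xs t. K (x # xs) (s + t)))"
  unfolding wp_def wps_def wpc_def by (subst evals.simps) (auto; blast)

lemmas wp_simps = wp_EVar wp_EAtom wp_EPair wp_EHd wp_ETl wp_EIf wp_ELet wp_ECall wps_Nil wps_Cons

lemma callI:
  assumes "f < 23" "wp xs (bcs_program ! f) (\<lambda>y t. y = v \<and> t \<le> T)"
  shows "call f xs v T"
  using assms by (simp add: call_def wpc_def bcs_program_def)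

lemma call_mono: "call f xs v T \<Longrightarrow> T \<le> T' \<Longrightarrow> call f xs v T'"
  by (auto simp: call_def wpc_def wp_def)

lemma program_nth:
  "bcs_program ! 0 = main_body" "bcs_program ! Suc 0 = add_body" "bcs_program ! 2 = mul_body"
  "bcs_program ! 3 = vadd_body" "bcs_program ! 4 = vmul_body" "bcs_program ! 5 = dot_body"
  "bcs_program ! 6 = matvec_body" "bcs_program ! 7 = conv_body" "bcs_program ! 8 = rev_body"
  "bcs_program ! 9 = walks_body" "bcs_program ! 10 = total_body" "bcs_program ! 11 = sub_body"
  "bcs_program ! 12 = build_body" "bcs_program ! 13 = eq_body" "bcs_program ! 14 = scan_body"
  "bcs_program ! 15 = reach_body" "bcs_program ! 16 = closure_body"
  "bcs_program ! 17 = atleast_body" "bcs_program ! 18 = decide_body"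
  "bcs_program ! 19 = maximum_body" "bcs_program ! 20 = prune_body" "bcs_program ! 21 = half_body"
  "bcs_program ! 22 = minor_body"
  by (simp_all add: bcs_program_def)

section \<open>Arithmetic and walk counting\<close>

lemma add_zero_call: "call 1 [Atom, Atom, Atom] Atom 20"
  by (rule callI) (simp_all add: program_nth add_body_def wp_simps)

lemma enc_add:
  assumes "a + b + of_bool c \<noteq> 0"
  shows "enc (a + b + of_bool c) =
    Pair (sexp_of_bool ((odd a \<noteq> odd b) \<noteq> c))
      (enc (a div 2 + b div 2 + of_bool (if c then odd a \<or> odd b else odd a \<and> odd b)))"
proof -
  have "(a + b + of_bool c) div 2 = a div 2 + b div 2 + of_bool (if c then odd a \<or> odd b else odd a
      \<and> odd b)"
    by (cases c; cases "odd a"; cases "odd b") (auto elim!: oddE evenE)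
  moreover have "odd (a + b + of_bool c) \<longleftrightarrow> ((odd a \<noteq> odd b) \<noteq> c)" by auto
  ultimately show ?thesis using assms by (simp add: enc.simps[of "a + b + of_bool c"])
qed

text \<open>The constants in this and the other time bounds are rounded up generously; only
  polynomial growth in the bit length and the number of vertices matters.\<close>

definition t_add :: "nat \<Rightarrow> nat" where
  "t_add L = 100 * L + 100"

lemma add_call_carry:
  "a < 2 ^ L \<Longrightarrow> b < 2 ^ L \<Longrightarrow>
     call 1 [sexp_of_bool c, enc a, enc b] (enc (a + b + of_bool c)) (t_add L)"
proof (induction L arbitrary: a b c)
  case 0
  \<comment> \<open>For L = 0 both summands vanish, but a carry may be left; writing it takes one
    more call, on three zeros.\<close>
  note z = add_zero_call[THEN callD]
  show ?case
    by (rule callI, simp) (use 0 z in \<open>auto simp: program_nth add_body_def wp_simps t_add_def split: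
        if_splits\<close>)
next
  case (Suc L)
  let ?d = "if c then odd a \<or> odd b else odd a \<and> odd b"
  have IH: "call 1 [sexp_of_bool d, enc (a div 2), enc (b div 2)]
      (enc (a div 2 + b div 2 + of_bool d)) (t_add L)" for d
    using Suc by (intro Suc.IH) auto
  note IH' = IH[of True, THEN callD] IH[of False, THEN callD]
  show ?case
  proof (cases "a + b + of_bool c = 0")
    case True
    then show ?thesis
      by (intro callI, simp) (simp add: program_nth add_body_def wp_simps t_add_def)
  next
    case False
    show ?thesis
      unfolding enc_add[OF False]
      by (rule callI, simp)
        (use False IH' in \<open>cases c; cases "a = 0"; cases "b = 0"; cases "odd a"; cases "odd b";
          simp add: program_nth add_body_def wp_simps t_add_def\<close>)
  qed
qed

lemma add_call:
  assumes "a < 2 ^ L" "b < 2 ^ L"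
  shows "call 1 [Atom, enc a, enc b] (enc (a + b)) (t_add L)"
  using add_call_carry[OF assms, of False] by simp

definition t_mul :: "nat \<Rightarrow> nat" where
  "t_mul L = 100 + L * (t_add L + 100)"

lemma enc_double: "(if m = 0 then Atom else Pair Atom (enc m)) = enc (2 * m)"
  by (simp add: enc.simps[of "2 * m"])

text \<open>The induction is on the number k of bits of the first factor while L stays fixed: every
  partial product is at most the final one, so all additions fit into L bits.\<close>

lemma mul_call:
  assumes "a < 2 ^ L" "b < 2 ^ L" "a * b < 2 ^ L"
  shows "call 2 [enc a, enc b] (enc (a * b)) (t_mul L)"
proof -
  have "call 2 [enc a, enc b] (enc (a * b)) (100 + k * (t_add L + 100))" if "a < 2 ^ k" for k
    using that assms(3)
  proof (induction k arbitrary: a)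
    case 0
    then show ?case by (intro callI, simp) (simp add: program_nth mul_body_def wp_simps)
  next
    case (Suc k)
    show ?case
    proof (cases "a = 0")
      case True
      then show ?thesis by (intro callI, simp) (simp add: program_nth mul_body_def wp_simps)
    next
      case False
      obtain p where p: "a div 2 * b = p" by simp
      have ab: "a * b = (if odd a then b + 2 * p else 2 * p)"
        unfolding p[symmetric] by (cases "odd a") (auto elim!: oddE evenE simp: algebra_simps)
      have "call 2 [enc (a div 2), enc b] (enc p) (100 + k * (t_add L + 100))"
        unfolding p[symmetric] using Suc.prems ab p by (intro Suc.IH) (auto split: if_splits)
      note IH = this[THEN callD]
      have d: "0 < p \<Longrightarrow> Pair Atom (enc p) = enc (2 * p)"
        using enc_double[of p] by simp
      show ?thesis
      proof (cases "odd a")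
        case True
        have "call 1 [Atom, enc b, enc (2 * p)] (enc (b + 2 * p)) (t_add L)"
          using assms(2) Suc.prems ab True by (intro add_call) auto
        note ad = this[THEN callD]
        show ?thesis
          by (rule callI, simp)
            (use False True IH ad ab d in \<open>cases "p = 0"; auto simp: program_nth mul_body_def wp_simps\<close>)
      next
        case even: False
        show ?thesis
          by (rule callI, simp)
            (use False even IH ab d in \<open>cases "p = 0"; auto simp: program_nth mul_body_def wp_simps\<close>)
      qed
    qed
  qed
  from this[OF assms(1)] show ?thesis by (simp add: t_mul_def)
qed

definition t_vadd :: "nat \<Rightarrow> nat \<Rightarrow> nat" where
  "t_vadd L k = 100 + k * (t_add L + 100)"

lemma vadd_Atom_call: "call 3 [Atom, y] y (t_vadd L k)"
  by (rule callI, simp) (simp add: program_nth vadd_body_def wp_simps t_vadd_def)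

lemma vadd_call:
  "(\<And>v. v \<in> set l \<Longrightarrow> f v < 2 ^ L \<and> g v < 2 ^ L) \<Longrightarrow>
     call 3 [evec l f, evec l g] (evec l (\<lambda>v. f v + g v)) (t_vadd L (length l))"
proof (induction l)
  case Nil
  then show ?case by (simp add: vadd_Atom_call)
next
  case (Cons v l)
  have "call 3 [evec l f, evec l g] (evec l (\<lambda>v. f v + g v)) (t_vadd L (length l))"
    using Cons by auto
  note IH = this[THEN callD]
  have "call 1 [Atom, enc (f v), enc (g v)] (enc (f v + g v)) (t_add L)"
    using Cons.prems by (intro add_call) auto
  note ad = this[THEN callD]
  show ?case
    by (rule callI, simp) (use IH ad in \<open>simp add: program_nth vadd_body_def wp_simps t_vadd_def\<close>)
qed

definition t_vmul :: "nat \<Rightarrow> nat \<Rightarrow> nat" where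
  "t_vmul L k = 100 + k * (t_mul L + 100)"

lemma vmul_call:
  "(\<And>v. v \<in> set l \<Longrightarrow> f v < 2 ^ L \<and> g v < 2 ^ L \<and> f v * g v < 2 ^ L) \<Longrightarrow>
     call 4 [evec l f, evec l g] (evec l (\<lambda>v. f v * g v)) (t_vmul L (length l))"
proof (induction l)
  case Nil
  show ?case
    by (rule callI, simp) (simp add: program_nth vmul_body_def wp_simps t_vmul_def)
next
  case (Cons v l)
  have "call 4 [evec l f, evec l g] (evec l (\<lambda>v. f v * g v)) (t_vmul L (length l))"
    using Cons by auto
  note IH = this[THEN callD]
  have "call 2 [enc (f v), enc (g v)] (enc (f v * g v)) (t_mul L)"
    using Cons.prems by (intro mul_call) auto
  note mu = this[THEN callD]
  show ?case
    by (rule callI, simp) (use IH mu in \<open>simp add: program_nth vmul_body_def wp_simps t_vmul_def\<close>)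
qed

definition t_dot :: "nat \<Rightarrow> nat \<Rightarrow> nat" where
  "t_dot L k = 100 + k * (t_add L + 100)"

lemma dot_call:
  "(\<Sum>v\<leftarrow>l. if r v = Atom then 0 else f v) < 2 ^ L \<Longrightarrow>
     call 5 [sexp_of_list (map r l), evec l f] (enc (\<Sum>v\<leftarrow>l. if r v = Atom then 0 else f v))
       (t_dot L (length l))"
proof (induction l)
  case Nil
  show ?case
    by (rule callI, simp) (simp add: program_nth dot_body_def wp_simps t_dot_def)
next
  case (Cons v l)
  let ?s = "\<Sum>v\<leftarrow>l. if r v = Atom then 0 else f v"
  have "call 5 [sexp_of_list (map r l), evec l f] (enc ?s) (t_dot L (length l))"
    using Cons by auto
  note IH = this[THEN callD]
  show ?case
  proof (cases "r v = Atom")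
    case True
    then show ?thesis
      by (intro callI, simp) (use IH in \<open>simp add: program_nth dot_body_def wp_simps t_dot_def\<close>)
  next
    case False
    then have "call 1 [Atom, enc (f v), enc ?s] (enc (f v + ?s)) (t_add L)"
      using Cons.prems by (intro add_call) auto
    note ad = this[THEN callD]
    show ?thesis
      by (rule callI, simp) (use False IH ad in \<open>simp add: program_nth dot_body_def wp_simps t_dot_def\<close>)
  qed
qed

definition t_conv :: "nat \<Rightarrow> nat \<Rightarrow> nat \<Rightarrow> nat" where
  "t_conv L k m = 100 + m * (t_vadd L k + t_vmul L k + 100)"

lemma conv_call:
  assumes "l \<noteq> []"
  shows "(\<And>v a. v \<in> set l \<Longrightarrow> a \<in> set as \<Longrightarrow> F a v < 2 ^ L \<and> G a v < 2 ^ L) \<Longrightarrow>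
     (\<And>v. v \<in> set l \<Longrightarrow> (\<Sum>a\<leftarrow>as. F a v * G a v) < 2 ^ L) \<Longrightarrow>
     call 7 [sexp_of_list (map (\<lambda>a. evec l (F a)) as), sexp_of_list (map (\<lambda>a. evec l (G a)) as)]
       (if as = [] then Atom else evec l (\<lambda>v. \<Sum>a\<leftarrow>as. F a v * G a v))
       (t_conv L (length l) (length as))"
proof (induction as)
  case Nil
  show ?case
    by (rule callI, simp) (simp add: program_nth conv_body_def wp_simps t_conv_def)
next
  case (Cons a as)
  let ?s = "\<lambda>v. \<Sum>a\<leftarrow>as. F a v * G a v"
  have lt: "?s v < 2 ^ L" "F a v * G a v < 2 ^ L" if "v \<in> set l" for v
    using Cons.prems(2)[OF that] by auto
  have "call 7 [sexp_of_list (map (\<lambda>a. evec l (F a)) as), sexp_of_list (map (\<lambda>a. evec l (G a)) as)]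
       (if as = [] then Atom else evec l ?s) (t_conv L (length l) (length as))"
    using Cons.prems(1) lt by (intro Cons.IH) auto
  note IH = this[THEN callD]
  have "call 4 [evec l (F a), evec l (G a)] (evec l (\<lambda>v. F a v * G a v)) (t_vmul L (length l))"
    using Cons.prems(1) lt by (intro vmul_call) auto
  note mu = this[THEN callD]
  show ?case
  proof (cases "as = []")
    case True
    note ad = vadd_Atom_call[of "evec l (\<lambda>v. F a v * G a v)" L "length l", THEN callD]
    show ?thesis
      by (rule callI, simp) (use True IH mu ad in \<open>simp add: program_nth conv_body_def wp_simps
          t_conv_def\<close>)
  next
    case False
    have "call 3 [evec l ?s, evec l (\<lambda>v. F a v * G a v)] (evec l (\<lambda>v. ?s v + F a v * G a v))
        (t_vadd L (length l))"
      using lt by (intro vadd_call) auto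
    note ad = this[THEN callD]
    show ?thesis
      by (rule callI, simp)
        (use assms False IH mu ad in \<open>simp add: program_nth conv_body_def wp_simps t_conv_def
            add.commute\<close>)
  qed
qed

definition t_rev :: "nat \<Rightarrow> nat" where
  "t_rev k = 100 + k * 100"

lemma rev_call:
  "call 8 [sexp_of_list xs, sexp_of_list ys] (sexp_of_list (rev xs @ ys)) (t_rev (length xs))"
proof (induction xs arbitrary: ys)
  case Nil
  show ?case by (rule callI, simp) (simp add: program_nth rev_body_def wp_simps t_rev_def)
next
  case (Cons x xs)
  note IH = Cons.IH[of "x # ys", simplified, THEN callD]
  show ?case
    by (rule callI, simp) (use IH in \<open>simp add: program_nth rev_body_def wp_simps t_rev_def\<close>)
qed

lemma eq_call: "call 13 [a, b] (sexp_of_bool (a = b)) (100 + 300 * size a)"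
proof (induction a arbitrary: b)
  case Atom
  show ?case by (rule callI, simp) (cases b; simp add: program_nth eq_body_def wp_simps)
next
  case (Pair x y)
  show ?case
  proof (cases b)
    case Atom
    show ?thesis
      by (rule callI, simp) (simp add: program_nth eq_body_def wp_simps Atom)
  next
    case b: (Pair x' y')
    note IH = Pair.IH(1)[of x', THEN callD] Pair.IH(2)[of y', THEN callD]
    show ?thesis
      by (rule callI, simp) (use IH in \<open>cases "x = x'"; simp add: program_nth eq_body_def wp_simps b\<close>)
  qed
qed

text \<open>The factor 900 is the 300 steps per cell in \<open>eq_call\<close> times the 3 cells per
  bit in \<open>size_enc_le\<close>.\<close>

definition t_eq :: "nat \<Rightarrow> nat" where
  "t_eq L = 100 + 900 * L"

lemma eq_enc_call:
  assumes "a < 2 ^ L"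
  shows "call 13 [enc a, enc b] (sexp_of_bool (a = b)) (t_eq L)"
  using eq_call[of "enc a" "enc b"] size_enc_le[OF assms]
  by (auto simp: t_eq_def elim!: call_mono)

definition t_matvec :: "nat \<Rightarrow> nat \<Rightarrow> nat" where
  "t_matvec L k = 100 + k * (t_dot L k + 100)"

definition t_walks :: "nat \<Rightarrow> nat \<Rightarrow> nat" where
  "t_walks L k = 100 + 2 * k * (t_conv L k (2 * k) + t_rev (2 * k) + t_matvec L k + 200)"

definition t_total :: "nat \<Rightarrow> nat \<Rightarrow> nat" where
  "t_total L k = 200 + t_matvec L k + t_walks L k + t_dot L k"

lemma t_conv_mono: "m \<le> m' \<Longrightarrow> t_conv L k m \<le> t_conv L k m'"
  by (simp add: t_conv_def)

lemma t_rev_mono: "m \<le> m' \<Longrightarrow> t_rev m \<le> t_rev m'"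
  by (simp add: t_rev_def)

abbreviation ind :: "'a set \<Rightarrow> 'a \<Rightarrow> nat" where
  "ind S \<equiv> \<lambda>v. of_bool (v \<in> S)"

lemma evec_append_rev_call:
  "call 8 [evec (rev xs) f, evec ys g] (sexp_of_list (map (\<lambda>v. enc (f v)) xs @ map (\<lambda>v. enc (g v)) ys))
     (t_rev (length xs))"
  using rev_call[of "map (\<lambda>v. enc (f v)) (rev xs)" "map (\<lambda>v. enc (g v)) ys"]
  by (simp add: evec_def rev_map)

section \<open>Bit lengths and the computation of the walk counts\<close>

context listed_graph
begin

text \<open>Walk counts at a vertex are at most 2^(4n^2); summing over the vertices adds n to the
  exponent, and the at most n doublings of the Moebius transform add another n. One length above
  4n^2 + 2n thus fits all numbers that occur.\<close>

definition bits :: nat where "bits = 4 * n * n + 4 * n + 1"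

lemma W_le_bits:
  assumes "S \<subseteq> V" "1 \<le> m" "m \<le> 2 * n"
  shows "W S m v \<le> 2 ^ (4 * n * n)"
proof -
  have "2 * n * n \<le> 2 ^ (2 * n + 1)"
  proof -
    have "n * n \<le> 2 ^ n * 2 ^ n" using less_exp[of n] by (intro mult_le_mono) auto
    then show ?thesis by (simp add: mult_2 power_add distrib_right)
  qed
  then have "(2 * n * n) ^ (m - 1) \<le> (2 ^ (2 * n + 1)) ^ (m - 1)"
    by (rule power_mono) simp
  also have "\<dots> = 2 ^ ((2 * n + 1) * (m - 1))" by (simp only: power_mult)
  also have "\<dots> \<le> 2 ^ (4 * n * n)"
  proof (rule power_increasing)
    have "(2 * n + 1) * (m - 1) \<le> (2 * n + 1) * (2 * n - 1)" using assms by (intro mult_le_mono2) auto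
    also have "\<dots> \<le> 4 * n * n" by (cases n) (auto simp: algebra_simps)
    finally show "(2 * n + 1) * (m - 1) \<le> 4 * n * n" .
  qed simp
  finally show ?thesis using W_le[OF assms, of v] by linarith
qed

lemma le_bits: "x \<le> (2::nat) ^ (4 * n * n + 2 * n) \<Longrightarrow> x < 2 ^ bits"
proof -
  assume "x \<le> (2::nat) ^ (4 * n * n + 2 * n)"
  also have "(2::nat) ^ (4 * n * n + 2 * n) < 2 ^ bits"
    by (rule power_strict_increasing) (auto simp: bits_def)
  finally show ?thesis .
qed

lemma n_mult_le:
  assumes "x \<le> 2 ^ k"
  shows "n * x \<le> 2 ^ (k + n)"
  using mult_le_mono[OF less_imp_le[OF less_exp[of n]] assms] by (simp add: power_add mult.commute)

lemma W_bits:
  assumes "S \<subseteq> V" "1 \<le> m" "m \<le> 2 * n"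
  shows "W S m v < 2 ^ bits" "nbr_sum (W S m) v < 2 ^ bits" "total S m \<le> 2 ^ (4 * n * n + n)"
    "total S m < 2 ^ bits"
proof -
  note W = W_le_bits[OF assms]
  have p: "(2::nat) ^ (4 * n * n) \<le> 2 ^ (4 * n * n + 2 * n)"
      "(2::nat) ^ (4 * n * n + n) \<le> 2 ^ (4 * n * n + 2 * n)"
    by (intro power_increasing; simp)+
  show "W S m v < 2 ^ bits" by (rule le_bits[OF order_trans[OF W p(1)]])
  have "nbr_sum (W S m) v \<le> n * 2 ^ (4 * n * n)" by (intro nbr_sum_le W)
  also have "\<dots> \<le> 2 ^ (4 * n * n + n)" by (intro n_mult_le) simp
  finally show "nbr_sum (W S m) v < 2 ^ bits" using p(2) by (rule le_bits[OF order_trans])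
  have "total S m \<le> (\<Sum>v\<leftarrow>vs. 2 ^ (4 * n * n))"
    unfolding total_def by (intro sum_list_mono W)
  also have "\<dots> = n * 2 ^ (4 * n * n)" by (simp add: sum_list_triv n_def)
  also have "\<dots> \<le> 2 ^ (4 * n * n + n)" by (intro n_mult_le) simp
  finally show t: "total S m \<le> 2 ^ (4 * n * n + n)" .
  then show "total S m < 2 ^ bits" using p(2) by (rule le_bits[OF order_trans])
qed

lemma closure_bits:
  assumes "\<And>v. r v \<le> 1" "j \<le> n"
  shows "closure S r j v < 2 ^ bits" "nbr_sum (closure S r j) v < 2 ^ bits"
proof -
  have c: "closure S r j v \<le> 2 ^ (n * n)" for v
  proof -
    have "closure S r j v \<le> (n + 1) ^ j" using assms(1) by (rule closure_le)
    also have "\<dots> \<le> (2 ^ n) ^ j" using Suc_leI[OF less_exp[of n]] by (intro power_mono) auto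
    also have "\<dots> \<le> (2 ^ n) ^ n" using assms(2) by (intro power_increasing) auto
    finally show ?thesis by (simp add: power_mult)
  qed
  have "(2::nat) ^ (n * n) \<le> 2 ^ (4 * n * n + 2 * n)" by (rule power_increasing) auto
  then show "closure S r j v < 2 ^ bits" using c[of v] by (intro le_bits) (rule order_trans)
  have "nbr_sum (closure S r j) v \<le> n * 2 ^ (n * n)" by (intro nbr_sum_le c)
  also have "\<dots> \<le> 2 ^ (n * n + n)" by (intro n_mult_le) simp
  also have "(2::nat) ^ (n * n + n) \<le> 2 ^ (4 * n * n + 2 * n)" by (rule power_increasing) auto
  finally show "nbr_sum (closure S r j) v < 2 ^ bits" by (rule le_bits)
qed

lemma one_bits: "1 < (2::nat) ^ bits"
  by (rule one_less_power) (auto simp: bits_def)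

definition instance_code :: "('a \<Rightarrow> bool) \<Rightarrow> sexp" where
  "instance_code col = sexp_of_list
     (map (\<lambda>v. Pair (sexp_of_bool (col v)) (sexp_of_list (map (\<lambda>w. sexp_of_bool (E v w)) vs))) vs)"

lemma matvec_call:
  assumes "\<And>v. nbr_sum f v < 2 ^ L"
  shows "call 6 [instance_code col, evec vs f] (evec vs (nbr_sum f)) (t_matvec L n)"
proof -
  have "call 6 [sexp_of_list (map (\<lambda>v. Pair (sexp_of_bool (col v))
            (sexp_of_list (map (\<lambda>w. sexp_of_bool (E v w)) vs))) l), evec vs f]
          (evec l (nbr_sum f)) (100 + length l * (t_dot L n + 100))" for l
  proof (induction l)
    case Nil
    show ?case by (rule callI, simp) (simp add: program_nth matvec_body_def wp_simps)
  next
    case (Cons v l)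
    have "(\<Sum>w\<leftarrow>vs. if sexp_of_bool (E v w) = Atom then 0 else f w) = nbr_sum f v"
      unfolding nbr_sum_def by (intro arg_cong[where f = sum_list] map_cong) auto
    then have "call 5 [sexp_of_list (map (\<lambda>w. sexp_of_bool (E v w)) vs), evec vs f]
        (enc (nbr_sum f v)) (t_dot L n)"
      using dot_call[of "\<lambda>w. sexp_of_bool (E v w)" f vs L] assms[of v] by (simp only: n_def)
    note d = this[THEN callD]
    show ?case
      by (rule callI, simp)
        (use Cons.IH[THEN callD] d in \<open>simp add: program_nth matvec_body_def wp_simps\<close>)
  qed
  from this[of vs] show ?thesis by (simp add: instance_code_def t_matvec_def n_def)
qed

text \<open>The vectors \<open>F j, ..., F 1\<close> computed so far, the newest first.\<close>

definition hist :: "(nat \<Rightarrow> 'a \<Rightarrow> nat) \<Rightarrow> nat \<Rightarrow> sexp" where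
  "hist F j = sexp_of_list (map (\<lambda>a. evec vs (F a)) (rev [1..<Suc j]))"

lemma hist_Suc: "hist F (Suc j) = Pair (evec vs (F (Suc j))) (hist F j)"
  by (simp add: hist_def)

lemma hist_0: "hist F 0 = Atom"
  by (simp add: hist_def)

lemma rev_upt_eq: "rev [1..<Suc j] = map (\<lambda>a. Suc j - a) [1..<Suc j]"
  by (rule nth_equalityI) (auto simp: rev_nth simp del: upt_Suc)

lemma hist_eq: "hist F j = sexp_of_list (map (\<lambda>a. evec vs (F (Suc j - a))) [1..<Suc j])"
  unfolding hist_def rev_upt_eq by (simp add: comp_def del: upt_Suc)

lemma walks_call:
  assumes S: "S \<subseteq> V" and ne: "vs \<noteq> []"
  shows "1 \<le> j \<Longrightarrow> j + length ks \<le> 2 * n \<Longrightarrow>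
    call 9 [instance_code col, sexp_of_list ks, hist (W S) j, hist (\<lambda>a. nbr_sum (W S a)) j]
      (evec vs (W S (j + length ks)))
      (100 + length ks * (t_conv bits n (2 * n) + t_rev (2 * n) + t_matvec bits n + 200))"
proof (induction ks arbitrary: j)
  case Nil
  then have "hd_sexp (hist (W S) j) = evec vs (W S j)" by (cases j) (auto simp: hist_Suc)
  then show ?case by (intro callI, simp) (simp add: program_nth walks_body_def wp_simps)
next
  case (Cons k ks)
  let ?U = "\<lambda>a. nbr_sum (W S a)"
  let ?as = "[1..<Suc j]"
  have j: "Suc j \<ge> 2" "Suc j \<le> 2 * n" using Cons.prems by auto
  have "call 8 [hist (W S) j, Atom] (sexp_of_list (map (\<lambda>a. evec vs (W S a)) ?as)) (t_rev (2 * n))"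
    using rev_call[of "map (\<lambda>a. evec vs (W S a)) (rev ?as)" "[]"] t_rev_mono[of j "2 * n"] j
    by (auto simp: hist_def rev_map[symmetric] simp del: upt_Suc elim!: call_mono)
  note r = this[THEN callD]
  \<comment> \<open>After the reversal the first history is oldest first and the second newest
    first, so position a pairs the counts for a and for \<open>Suc j - a\<close> nodes.\<close>
  have Wr: "(\<Sum>a\<leftarrow>?as. W S a v * ?U (Suc j - a) v) = W S (Suc j) v" for v
    using W_rec[OF j(1) S] by simp
  have "call 7 [sexp_of_list (map (\<lambda>a. evec vs (W S a)) ?as), hist ?U j] (evec vs (W S (Suc j)))
     (t_conv bits (length vs) (length ?as))"
  proof -
    have "\<And>v a. v \<in> V \<Longrightarrow> a \<in> set ?as \<Longrightarrow> W S a v < 2 ^ bits \<and> ?U (Suc j - a) v < 2 ^ bits"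
      using j W_bits(1,2)[OF S] by (auto simp del: upt_Suc)
    moreover have "\<And>v. (\<Sum>a\<leftarrow>?as. W S a v * ?U (Suc j - a) v) < 2 ^ bits"
      unfolding Wr using W_bits(1)[OF S _ j(2)] by simp
    ultimately have "call 7 [sexp_of_list (map (\<lambda>a. evec vs (W S a)) ?as), hist ?U j]
        (if ?as = [] then Atom else evec vs (\<lambda>v. \<Sum>a\<leftarrow>?as. W S a v * ?U (Suc j - a) v))
       (t_conv bits (length vs) (length ?as))"
      unfolding hist_eq by (intro conv_call ne)
    then show ?thesis unfolding Wr using Cons.prems by (simp del: upt_Suc)
  qed
  then have "call 7 [sexp_of_list (map (\<lambda>a. evec vs (W S a)) ?as), hist ?U j] (evec vs (W S (Suc j)))
     (t_conv bits n (2 * n))"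
    using j by (elim call_mono) (auto simp: n_def intro!: t_conv_mono)
  note c = this[THEN callD]
  have "call 6 [instance_code col, evec vs (W S (Suc j))] (evec vs (?U (Suc j))) (t_matvec bits n)"
    using W_bits(2)[OF S _ j(2)] by (intro matvec_call) simp
  note m = this[THEN callD]
  have "call 9 [instance_code col, sexp_of_list ks, Pair (evec vs (W S (Suc j))) (hist (W S) j),
      Pair (evec vs (?U (Suc j))) (hist ?U j)]
      (evec vs (W S (Suc j + length ks)))
      (100 + length ks * (t_conv bits n (2 * n) + t_rev (2 * n) + t_matvec bits n + 200))"
    using Cons.IH[of "Suc j"] Cons.prems by (simp add: hist_Suc)
  note IH = this[THEN callD]
  show ?case
    by (rule callI, simp)
      (use r c m IH in \<open>simp add: program_nth walks_body_def wp_simps del: upt_Suc\<close>)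
qed

lemma total_call:
  assumes S: "S \<subseteq> V" and ks: "Suc (length ks) \<le> 2 * n"
  shows "call 10 [instance_code col, evec vs (ind S), sexp_of_list ks] (enc (total S (Suc (length ks))))
    (t_total bits n)"
proof -
  let ?U = "\<lambda>a. nbr_sum (W S a)"
  have ne: "vs \<noteq> []" using ks by (auto simp: n_def)
  have W1: "W S 1 = ind S" by (rule ext) (rule W_1)
  have "1 \<le> 2 * n" using ks by simp
  then have "call 6 [instance_code col, evec vs (W S 1)] (evec vs (?U 1)) (t_matvec bits n)"
    using W_bits(2)[OF S, of 1] by (intro matvec_call) simp
  note m = this[unfolded W1, THEN callD]
  have "call 9 [instance_code col, sexp_of_list ks, hist (W S) 1, hist ?U 1]
      (evec vs (W S (1 + length ks)))
      (100 + length ks * (t_conv bits n (2 * n) + t_rev (2 * n) + t_matvec bits n + 200))"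
    using ks by (intro walks_call[OF S ne]) auto
  then have "call 9 [instance_code col, sexp_of_list ks, hist (W S) 1, hist ?U 1]
      (evec vs (W S (1 + length ks))) (t_walks bits n)"
    using ks by (elim call_mono) (auto simp: t_walks_def intro!: mult_le_mono)
  moreover have "hist F 1 = Pair (evec vs (F 1)) Atom" for F
    using hist_Suc[of F 0] by (simp add: hist_0)
  ultimately have "call 9 [instance_code col, sexp_of_list ks, Pair (evec vs (ind S)) Atom,
      Pair (evec vs (nbr_sum (ind S))) Atom]
      (evec vs (W S (Suc (length ks)))) (t_walks bits n)"
    by (simp only: W1) simp
  note w = this[THEN callD]
  \<comment> \<open>The vector is its own mask: zero is coded as \<open>Atom\<close>, so only zero
    summands are skipped and the inner product is the plain sum of the entries.\<close>
  have sum: "(\<Sum>v\<leftarrow>vs. if enc (W S (Suc (length ks)) v) = Atom then 0 else W S (Suc (length ks)) v)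
      = total S (Suc (length ks))"
    unfolding total_def by (intro arg_cong[where f = sum_list] map_cong) auto
  have "call 5 [evec vs (W S (Suc (length ks))), evec vs (W S (Suc (length ks)))]
      (enc (total S (Suc (length ks)))) (t_dot bits n)"
    using dot_call[of "\<lambda>v. enc (W S (Suc (length ks)) v)" "W S (Suc (length ks))" vs bits]
      W_bits(4)[OF S _ ks]
    unfolding sum by (simp add: evec_def n_def)
  note d = this[THEN callD]
  show ?thesis
    by (rule callI, simp)
      (use m w d W1 in \<open>simp add: program_nth total_body_def wp_simps t_total_def\<close>)
qed

end

section \<open>Inclusion-exclusion over the minority vertices\<close>

definition br :: "'a set \<Rightarrow> 'a list \<Rightarrow> nat" where
  "br B l = length (filter (\<lambda>v. v \<in> B) l)"

lemma br_simps: "br B [] = 0" "br B (v # l) = (if v \<in> B then Suc (br B l) else br B l)"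
  by (simp_all add: br_def)

text \<open>
  The leaves of the tree are indexed by the subsets \<open>X\<close> of \<open>B \<inter> set l\<close> and hold the pairs
  \<open>(p X, q X)\<close>, read as the integers \<open>p X - q X\<close>.
\<close>

primrec tree :: "'a set \<Rightarrow> 'a list \<Rightarrow> ('a set \<Rightarrow> nat) \<Rightarrow> ('a set \<Rightarrow> nat) \<Rightarrow> sexp" where
  "tree B [] p q = Pair (enc (p {})) (enc (q {}))"
| "tree B (v # l) p q =
     (if v \<in> B then Pair (tree B l p q) (tree B l (\<lambda>X. p (insert v X)) (\<lambda>X. q (insert v X)))
      else tree B l p q)"

lemma tree_cong:
  "(\<And>X. X \<subseteq> set l \<Longrightarrow> p X = p' X \<and> q X = q' X) \<Longrightarrow> tree B l p q = tree B l p' q'"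
proof (induction l arbitrary: p q p' q')
  case (Cons v l)
  have "tree B l p q = tree B l p' q'" using Cons.prems by (intro Cons.IH) auto
  moreover have "tree B l (\<lambda>X. p (insert v X)) (\<lambda>X. q (insert v X)) =
      tree B l (\<lambda>X. p' (insert v X)) (\<lambda>X. q' (insert v X))"
    using Cons.prems by (intro Cons.IH) (metis insert_mono list.simps(15))
  ultimately show ?case by simp
qed simp

text \<open>Induction step for a time bound of the shape 2^b times (length + 1) times K, with b the
  number of branching vertices. P doubles at a branch, and the increment of the length factor pays
  for the work c at the node itself.\<close>

lemma branch_time:
  fixes P K k t1 t2 :: nat
  assumes "t1 \<le> P * ((k + 1) * K)" "t2 \<le> P * ((k + 1) * K)" "c \<le> K" "1 \<le> P"
  shows "t1 + t2 + c \<le> 2 * P * ((Suc k + 1) * K)"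
proof -
  have "K \<le> P * K" using assms(4) by simp
  moreover have "2 * P * ((Suc k + 1) * K) = P * ((k + 1) * K) + P * ((k + 1) * K) + 2 * (P * K)"
    by (simp add: algebra_simps)
  ultimately show ?thesis using assms(1-3) by linarith
qed

lemma skip_time:
  fixes P K k t :: nat
  assumes "t \<le> P * ((k + 1) * K)" "c \<le> K" "1 \<le> P"
  shows "t + c \<le> P * ((Suc k + 1) * K)"
proof -
  have "K \<le> P * K" using assms(3) by simp
  moreover have "P * ((Suc k + 1) * K) = P * ((k + 1) * K) + P * K"
    by (simp add: algebra_simps)
  ultimately show ?thesis using assms(1-2) by linarith
qed

definition t_sub :: "nat \<Rightarrow> nat" where
  "t_sub L = 2 * t_add L + 100"

lemma sub_call:
  "(\<And>X. X \<subseteq> set l \<Longrightarrow> p X < 2 ^ L \<and> q X < 2 ^ L \<and> p' X < 2 ^ L \<and> q' X < 2 ^ L) \<Longrightarrow>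
   call 11 [evec l (ind B), tree B l p q, tree B l p' q']
     (tree B l (\<lambda>X. p X + q' X) (\<lambda>X. q X + p' X)) (2 ^ br B l * ((length l + 1) * t_sub L))"
proof (induction l arbitrary: p q p' q')
  case Nil
  then have "call 1 [Atom, enc (p {}), enc (q' {})] (enc (p {} + q' {})) (t_add L)"
      "call 1 [Atom, enc (q {}), enc (p' {})] (enc (q {} + p' {})) (t_add L)"
    using Nil[of "{}"] by (auto intro!: add_call[simplified])
  note ad = this[THEN callD]
  show ?case
    by (rule callI, simp) (use ad in \<open>simp add: program_nth sub_body_def wp_simps t_sub_def br_simps\<close>)
next
  case (Cons v l)
  obtain T where T: "T = 2 ^ br B l * ((length l + 1) * t_sub L)" by blast
  have "call 11 [evec l (ind B), tree B l p q, tree B l p' q']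
     (tree B l (\<lambda>X. p X + q' X) (\<lambda>X. q X + p' X)) T"
    unfolding T by (intro Cons.IH Cons.prems) auto
  note IH1 = this[THEN callD]
  show ?case
  proof (cases "v \<in> B")
    case True
    let ?i = "\<lambda>p X. p (insert v X)"
    have "call 11 [evec l (ind B), tree B l (?i p) (?i q), tree B l (?i p') (?i q')]
       (tree B l (\<lambda>X. ?i p X + ?i q' X) (\<lambda>X. ?i q X + ?i p' X)) T"
      unfolding T by (intro Cons.IH Cons.prems) auto
    note IH2 = this[THEN callD]
    have "call 11 [evec (v # l) (ind B), tree B (v # l) p q, tree B (v # l) p' q']
        (tree B (v # l) (\<lambda>X. p X + q' X) (\<lambda>X. q X + p' X)) (T + T + 100)"
      by (rule callI, simp) (use True IH1 IH2 in \<open>simp add: program_nth sub_body_def wp_simps\<close>)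
    moreover have "T + T + 100 \<le> 2 * 2 ^ br B l * ((Suc (length l) + 1) * t_sub L)"
      by (rule branch_time) (simp_all add: T t_sub_def)
    ultimately show ?thesis using True by (elim call_mono) (simp add: br_simps)
  next
    case False
    have "call 11 [evec (v # l) (ind B), tree B (v # l) p q, tree B (v # l) p' q']
        (tree B (v # l) (\<lambda>X. p X + q' X) (\<lambda>X. q X + p' X)) (T + 100)"
      by (rule callI, simp) (use False IH1 in \<open>simp add: program_nth sub_body_def wp_simps\<close>)
    moreover have "T + 100 \<le> 2 ^ br B l * ((Suc (length l) + 1) * t_sub L)"
      by (rule skip_time) (simp_all add: T t_sub_def)
    ultimately show ?thesis using False by (elim call_mono) (simp add: br_simps)
  qed
qed

definition t_atleast :: "nat \<Rightarrow> nat" where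
  "t_atleast k = 100 + k * 100"

lemma atleast_call:
  "distinct l \<Longrightarrow> call 17 [evec l (ind B), evec l x, sexp_of_list ks]
     (sexp_of_bool (length ks \<le> card {v \<in> set l. x v > 0 \<and> v \<notin> B})) (t_atleast (length l))"
proof (induction l arbitrary: ks)
  case Nil
  show ?case
    by (rule callI, simp) (simp add: program_nth atleast_body_def wp_simps t_atleast_def)
next
  case (Cons v l)
  let ?A = "{v \<in> set l. x v > 0 \<and> v \<notin> B}"
  have v: "v \<notin> set l" using Cons.prems by simp
  have "{w \<in> set (v # l). x w > 0 \<and> w \<notin> B} = (if x v > 0 \<and> v \<notin> B then insert v ?A else ?A)"
    by auto
  then have c: "card {w \<in> set (v # l). x w > 0 \<and> w \<notin> B} =
      (if x v > 0 \<and> v \<notin> B then Suc (card ?A) else card ?A)"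
    using v by simp
  have IH: "call 17 [evec l (ind B), evec l x, sexp_of_list ks]
     (sexp_of_bool (length ks \<le> card ?A)) (t_atleast (length l))" for ks
    using Cons by simp
  note IH' = IH[of ks, THEN callD] IH[of "tl ks", THEN callD]
  show ?case
    unfolding c
    by (rule callI, simp)
      (use IH' in \<open>cases "x v = 0"; cases "v \<in> B"; cases ks;
        simp add: program_nth atleast_body_def wp_simps t_atleast_def\<close>)
qed

definition t_closure :: "nat \<Rightarrow> nat \<Rightarrow> nat" where
  "t_closure L k = 100 + k * (t_vadd L k + t_vmul L k + t_matvec L k + 200)"

definition t_reach :: "nat \<Rightarrow> nat \<Rightarrow> nat" where
  "t_reach L k = 100 + t_vmul L k + t_closure L k + t_atleast k"

context listed_graph
begin

lemma closure_call:
  assumes "\<And>v. r v \<le> 1"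
  shows "j + length ks \<le> n \<Longrightarrow>
    call 16 [instance_code col, evec vs (ind S), sexp_of_list ks, evec vs (closure S r j)]
      (evec vs (closure S r (j + length ks)))
      (100 + length ks * (t_vadd bits n + t_vmul bits n + t_matvec bits n + 200))"
proof (induction ks arbitrary: j)
  case Nil
  show ?case by (rule callI, simp) (simp add: program_nth closure_body_def wp_simps)
next
  case (Cons k ks)
  let ?c = "closure S r j"
  have j: "j \<le> n" "Suc j \<le> n" using Cons.prems by auto
  note b = closure_bits[OF assms j(1)]
  have "call 6 [instance_code col, evec vs ?c] (evec vs (nbr_sum ?c)) (t_matvec bits n)"
    by (intro matvec_call b)
  note m = this[THEN callD]
  have sum: "?c v + of_bool (v \<in> S) * nbr_sum ?c v < 2 ^ bits" for v
    using closure_bits(1)[OF assms j(2), where S = S and v = v] by simp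
  then have le: "of_bool (v \<in> S) * nbr_sum ?c v < 2 ^ bits" for v
    using add_lessD1 add.commute by metis
  have "call 4 [evec vs (ind S), evec vs (nbr_sum ?c)] (evec vs (\<lambda>v. of_bool (v \<in> S) * nbr_sum ?c v))
      (t_vmul bits n)"
    unfolding n_def using b le one_bits by (intro vmul_call conjI) auto
  note mu = this[THEN callD]
  have "call 3 [evec vs ?c, evec vs (\<lambda>v. of_bool (v \<in> S) * nbr_sum ?c v)]
      (evec vs (\<lambda>v. ?c v + of_bool (v \<in> S) * nbr_sum ?c v)) (t_vadd bits n)"
    unfolding n_def using b le by (intro vadd_call conjI) auto
  then have "call 3 [evec vs ?c, evec vs (\<lambda>v. of_bool (v \<in> S) * nbr_sum ?c v)]
      (evec vs (closure S r (Suc j))) (t_vadd bits n)"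
    by (simp only: closure.simps)
  note ad = this[THEN callD]
  have "call 16 [instance_code col, evec vs (ind S), sexp_of_list ks, evec vs (closure S r (Suc j))]
      (evec vs (closure S r (Suc j + length ks)))
      (100 + length ks * (t_vadd bits n + t_vmul bits n + t_matvec bits n + 200))"
    using Cons.IH[of "Suc j"] Cons.prems by simp
  note IH = this[THEN callD]
  show ?case
    by (rule callI, simp)
      (use m mu ad IH in \<open>simp add: program_nth closure_body_def wp_simps del: closure.simps\<close>)
qed

end

context colored_graph
begin

text \<open>At a leaf the program holds only the whole allowed set Z; the chosen set X is recovered
  from it as \<open>Z \<inter> B\<close>.\<close>

definition wide :: "'a set \<Rightarrow> 'a set \<Rightarrow> nat \<Rightarrow> bool" where
  "wide B Z k \<longleftrightarrow> k \<le> card {v \<in> V. reach Z (Z \<inter> B) v > 0 \<and> v \<notin> B}"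

lemma reach_call:
  "call 15 [instance_code col, evec vs (ind B), evec vs (ind Z), sexp_of_list ks]
     (sexp_of_bool (wide B Z (length ks))) (t_reach bits n)"
proof -
  have "call 4 [evec vs (ind Z), evec vs (ind B)] (evec vs (\<lambda>v. ind Z v * ind B v)) (t_vmul bits n)"
    unfolding n_def using one_bits by (intro vmul_call conjI) auto
  moreover have "(\<lambda>v. ind Z v * ind B v) = ind (Z \<inter> B)" by auto
  ultimately have "call 4 [evec vs (ind Z), evec vs (ind B)] (evec vs (ind (Z \<inter> B))) (t_vmul bits n)"
    by simp
  note mu = this[THEN callD]
  have ic: "instance_code col = sexp_of_list
     (map (\<lambda>v. Pair (sexp_of_bool (col v)) (sexp_of_list (map (\<lambda>w. sexp_of_bool (E v w)) vs))) vs)"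
    by (rule instance_code_def)
  have "call 16 [instance_code col, evec vs (ind Z), instance_code col, evec vs (ind (Z \<inter> B))]
      (evec vs (reach Z (Z \<inter> B))) (t_closure bits n)"
    using closure_call[of "ind (Z \<inter> B)" 0
        "map (\<lambda>v. Pair (sexp_of_bool (col v)) (sexp_of_list (map (\<lambda>w. sexp_of_bool (E v w)) vs))) vs" col
            Z]
    by (simp add: reach_def t_closure_def ic[symmetric] n_def[symmetric])
  note c = this[THEN callD]
  note a = atleast_call[OF distinct_vs, of B "reach Z (Z \<inter> B)" ks, folded n_def wide_def, THEN callD]
  show ?thesis
    by (rule callI, simp)
      (use mu c a in \<open>simp add: program_nth reach_body_def wp_simps t_reach_def\<close>)
qed

end

text \<open>While the tree is built, the extra work at a branch is the subtraction of an entire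
  subtree and thus proportional to P. The length factor still absorbs it, which is the reason why
  the transform costs only a polynomial factor over the number of leaves.\<close>

lemma branch_time_scaled:
  fixes P K k t1 t2 :: nat
  assumes "t1 \<le> P * ((k + 1) * K)" "t2 \<le> P * ((k + 1) * K)" "c \<le> P * K"
  shows "t1 + t2 + c \<le> 2 * P * ((Suc k + 1) * K)"
proof -
  have "2 * P * ((Suc k + 1) * K) = P * ((k + 1) * K) + P * ((k + 1) * K) + 2 * (P * K)"
    by (simp add: algebra_simps)
  then show ?thesis using assms(1-3) by linarith
qed

definition t_build :: "nat \<Rightarrow> nat \<Rightarrow> nat" where
  "t_build L k = (k + 1) * t_sub L + t_total L k + t_rev k + 200"

definition t_scan :: "nat \<Rightarrow> nat \<Rightarrow> nat" where
  "t_scan L k = t_rev k + t_eq L + t_reach L k + 200"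

definition t_decide :: "nat \<Rightarrow> nat \<Rightarrow> nat" where
  "t_decide L k = 300 + t_vmul L k + t_rev k + (k + 1) * t_build L k + (k + 1) * t_scan L k"

context colored_graph
begin

lemma mob_bits:
  assumes "vs = pre @ l" "Y \<subseteq> V" "1 \<le> m" "m \<le> 2 * n"
  shows "mob D m l Y s X < 2 ^ bits"
proof -
  have "mob D m l Y s X \<le> 2 ^ length l * 2 ^ (4 * n * n + n)"
    using assms by (intro mob_le W_bits(3)) auto
  also have "\<dots> = 2 ^ (length l + (4 * n * n + n))" by (simp add: power_add)
  also have "\<dots> \<le> 2 ^ (4 * n * n + 2 * n)"
  proof -
    have "length l \<le> n" unfolding n_def using assms(1) by simp
    then show ?thesis by (intro power_increasing) auto
  qed
  finally show ?thesis by (rule le_bits)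
qed

text \<open>Invariant: \<open>pre\<close> is the processed prefix, and Y is the part of it that
  walks may use. The leaves below the current node then hold the two parts of the alternating sums
  over the rest of the list.\<close>

lemma build_call:
  assumes ks: "Suc (length ks) \<le> 2 * n"
  shows "vs = pre @ l \<Longrightarrow> Y \<subseteq> set pre \<Longrightarrow>
    call 12 [instance_code col, evec l (ind (D \<inter> M)), evec l (ind D), evec (rev pre) (ind Y),
        sexp_of_list ks]
      (tree (D \<inter> M) l (mob D (Suc (length ks)) l Y True) (mob D (Suc (length ks)) l Y False))
      (2 ^ br (D \<inter> M) l * ((length l + 1) * t_build bits n))"
proof (induction l arbitrary: pre Y)
  case Nil
  then have Y: "Y \<subseteq> V" by simp
  have "call 8 [evec (rev pre) (ind Y), Atom] (evec pre (ind Y)) (t_rev (length pre))"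
    using evec_append_rev_call[of pre "ind Y" "[]" "\<lambda>_. 0"] by (simp add: evec_def)
  moreover have "evec pre (ind Y) = evec vs (ind Y)" "length pre = n"
    unfolding n_def using Nil.prems(1) by simp_all
  ultimately have "call 8 [evec (rev pre) (ind Y), Atom] (evec vs (ind Y)) (t_rev n)"
    by (simp only:)
  note r = this[THEN callD]
  note t = total_call[OF Y ks, of col, THEN callD]
  show ?case
    by (rule callI, simp)
      (use r t in \<open>simp add: program_nth build_body_def wp_simps t_build_def br_simps\<close>)
next
  case (Cons v l)
  let ?m = "Suc (length ks)" and ?B = "D \<inter> M"
  have pre: "vs = (pre @ [v]) @ l" using Cons.prems by simp
  have v: "v \<notin> set pre" "v \<notin> set l" "v \<notin> Y" "v \<in> V" "Y \<subseteq> V"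
    using distinct_vs Cons.prems by auto
  have skip: "evec (rev (pre @ [v])) (ind Y) = Pair Atom (evec (rev pre) (ind Y))"
    using v by simp
  have take: "evec (rev (pre @ [v])) (ind (insert v Y))
      = Pair (Pair (Pair Atom Atom) Atom) (evec (rev pre) (ind Y))"
    using v by (auto intro!: evec_cong)
  obtain T where T: "T = 2 ^ br ?B l * ((length l + 1) * t_build bits n)" by blast
  have IH: "call 12 [instance_code col, evec l (ind ?B), evec l (ind D), evec (rev (pre @ [v])) (ind Z),
      sexp_of_list ks]
      (tree ?B l (mob D ?m l Z True) (mob D ?m l Z False)) T" if "Z \<subseteq> set (pre @ [v])" for Z
    unfolding T by (rule Cons.IH[OF pre that])
  show ?case
  proof (cases "v \<in> ?B")
    case True
    have "call 12 [instance_code col, evec l (ind ?B), evec l (ind D), Pair Atom (evec (rev pre) (ind Y)),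
        sexp_of_list ks]
      (tree ?B l (mob D ?m l Y True) (mob D ?m l Y False)) T"
      unfolding skip[symmetric] using Cons.prems by (intro IH) auto
    note L = this[THEN callD]
    have "call 12 [instance_code col, evec l (ind ?B), evec l (ind D),
        Pair (Pair (Pair Atom Atom) Atom) (evec (rev pre) (ind Y)), sexp_of_list ks]
      (tree ?B l (mob D ?m l (insert v Y) True) (mob D ?m l (insert v Y) False)) T"
      unfolding take[symmetric] using Cons.prems by (intro IH) auto
    note R = this[THEN callD]
    obtain T' where T': "T' = 2 ^ br ?B l * ((length l + 1) * t_sub bits)" by blast
    have "call 11 [evec l (ind ?B), tree ?B l (mob D ?m l (insert v Y) True)
        (mob D ?m l (insert v Y) False),
        tree ?B l (mob D ?m l Y True) (mob D ?m l Y False)]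
      (tree ?B l (\<lambda>X. mob D ?m l (insert v Y) True X + mob D ?m l Y False X)
        (\<lambda>X. mob D ?m l (insert v Y) False X + mob D ?m l Y True X)) T'"
      unfolding T' using v ks by (intro sub_call conjI mob_bits[OF pre]) auto
    \<comment> \<open>\<open>mob\<close> reads its set argument only on the rest of the list, which
      does not contain v; hence the crosswise sums are the values of the recursion at
      \<open>insert v X\<close>.\<close>
    moreover have "tree ?B l (\<lambda>X. mob D ?m l (insert v Y) True X + mob D ?m l Y False X)
        (\<lambda>X. mob D ?m l (insert v Y) False X + mob D ?m l Y True X) =
      tree ?B l (\<lambda>X. mob D ?m (v # l) Y True (insert v X)) (\<lambda>X. mob D ?m (v # l) Y False (insert v X))"
    proof (rule tree_cong)
      fix X
      have "mob D ?m l Z s (insert v X) = mob D ?m l Z s X" for Z s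
        using v by (intro mob_cong) auto
      then show "mob D ?m l (insert v Y) True X + mob D ?m l Y False X
          = mob D ?m (v # l) Y True (insert v X) \<and>
        mob D ?m l (insert v Y) False X + mob D ?m l Y True X = mob D ?m (v # l) Y False (insert v X)"
        using True by simp
    qed
    ultimately have "call 11 [evec l (ind ?B), tree ?B l (mob D ?m l (insert v Y) True)
        (mob D ?m l (insert v Y) False),
        tree ?B l (mob D ?m l Y True) (mob D ?m l Y False)]
      (tree ?B l (\<lambda>X. mob D ?m (v # l) Y True (insert v X)) (\<lambda>X. mob D ?m (v # l) Y False (insert v X)))
          T'"
      by (simp only:)
    note S = this[THEN callD]
    have left: "tree ?B l (mob D ?m l Y True) (mob D ?m l Y False) =
      tree ?B l (mob D ?m (v # l) Y True) (mob D ?m (v # l) Y False)"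
    proof (rule tree_cong)
      fix X assume "X \<subseteq> set l"
      then have "v \<notin> X" using v by blast
      then show "mob D ?m l Y True X = mob D ?m (v # l) Y True X \<and> mob D ?m l Y False X
          = mob D ?m (v # l) Y False X"
        using True by simp
    qed
    have "call 12 [instance_code col, evec (v # l) (ind ?B), evec (v # l) (ind D), evec (rev pre) (ind Y),
        sexp_of_list ks]
        (tree ?B (v # l) (mob D ?m (v # l) Y True) (mob D ?m (v # l) Y False)) (T + T + (T' + 100))"
      unfolding tree.simps(2) if_P[OF True] left[symmetric]
      by (rule callI, simp)
        (use L R S True in \<open>simp add: program_nth build_body_def wp_simps del: mob.simps\<close>)
    moreover have "T + T + (T' + 100) \<le> 2 * 2 ^ br ?B l * ((Suc (length l) + 1) * t_build bits n)"
    proof (rule branch_time_scaled)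
      have "length l + 1 \<le> n + 1" unfolding n_def using pre by simp
      then have "(length l + 1) * t_sub bits + 100 \<le> t_build bits n"
        unfolding t_build_def by (intro add_mono trans_le_add1 mult_le_mono1) simp_all
      then have "2 ^ br ?B l * ((length l + 1) * t_sub bits + 100) \<le> 2 ^ br ?B l * t_build bits n"
        by (rule mult_le_mono2)
      then show "T' + 100 \<le> 2 ^ br ?B l * t_build bits n"
        unfolding T' distrib_left[of _ _ "100::nat"] using one_le_power[of "2::nat" "br ?B l"] by linarith
    qed (simp_all add: T)
    ultimately show ?thesis using True by (elim call_mono) (simp add: br_simps)
  next
    case False
    have acc: "Pair (enc (ind D v)) (evec (rev pre) (ind Y))
        = evec (rev (pre @ [v])) (ind (Y \<union> ({v} \<inter> D)))"
      using v by (auto intro!: evec_cong)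
    have "call 12 [instance_code col, evec l (ind ?B), evec l (ind D),
        Pair (enc (ind D v)) (evec (rev pre) (ind Y)), sexp_of_list ks]
      (tree ?B l (mob D ?m l (Y \<union> ({v} \<inter> D)) True) (mob D ?m l (Y \<union> ({v} \<inter> D)) False)) T"
      unfolding acc using Cons.prems by (intro IH) auto
    note L = this[THEN callD]
    have mob: "mob D ?m l (Y \<union> ({v} \<inter> D)) s = mob D ?m (v # l) Y s" for s
      using False by (intro ext) (simp only: mob.simps if_False)
    have "call 12 [instance_code col, evec (v # l) (ind ?B), evec (v # l) (ind D), evec (rev pre) (ind Y),
        sexp_of_list ks]
        (tree ?B (v # l) (mob D ?m (v # l) Y True) (mob D ?m (v # l) Y False)) (T + 100)"
      unfolding tree.simps(2) if_not_P[OF False] mob[symmetric]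
      by (rule callI, simp)
        (use L False in \<open>simp add: program_nth build_body_def wp_simps del: mob.simps\<close>)
    moreover have "T + 100 \<le> 2 ^ br ?B l * ((Suc (length l) + 1) * t_build bits n)"
      by (rule skip_time) (simp_all add: T t_build_def)
    ultimately show ?thesis using False by (elim call_mono) (simp add: br_simps)
  qed
qed

text \<open>The invariant of the scan: Y is the allowed part of the processed prefix, k the number
  of vertices of B still to be chosen, and \<open>k0\<close> the original target, which the size
  test needs at the leaf.\<close>

definition found :: "'a set \<Rightarrow> 'a set \<Rightarrow> nat \<Rightarrow> 'a list \<Rightarrow> 'a set \<Rightarrow> nat \<Rightarrow> ('a set \<Rightarrow> nat) \<Rightarrow> ('a set \<Rightarrow> nat) \<Rightarrow>
    bool" where
  "found B D k0 l Y k p q \<longleftrightarrow> (\<exists>X \<subseteq> B \<inter> set l. card X = k \<and> p X \<noteq> q X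
      \<and> wide B (Y \<union> X \<union> (D - B) \<inter> set l) k0)"

lemma found_Nil: "found B D k0 [] Y k p q \<longleftrightarrow> k = 0 \<and> p {} \<noteq> q {} \<and> wide B Y k0"
  by (auto simp: found_def)

lemma found_skip:
  assumes "v \<notin> B"
  shows "found B D k0 (v # l) Y k p q \<longleftrightarrow> found B D k0 l (Y \<union> ({v} \<inter> D)) k p q"
proof -
  have "B \<inter> set (v # l) = B \<inter> set l" using assms by auto
  moreover have "Y \<union> ({v} \<inter> D) \<union> X \<union> (D - B) \<inter> set l = Y \<union> X \<union> (D - B) \<inter> set (v # l)" for X
    using assms by auto
  ultimately show ?thesis by (simp only: found_def)
qed

lemma found_branch:
  assumes "v \<in> B" "v \<notin> set l"
  shows "found B D k0 (v # l) Y k p q \<longleftrightarrow>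
    found B D k0 l Y k p q \<or>
    k > 0 \<and> found B D k0 l (insert v Y) (k - 1) (\<lambda>X. p (insert v X)) (\<lambda>X. q (insert v X))"
  (is "?l \<longleftrightarrow> ?r")
proof
  have m: "(D - B) \<inter> set (v # l) = (D - B) \<inter> set l" using assms by auto
  assume ?l
  then obtain X where X: "X \<subseteq> B \<inter> set (v # l)" "card X = k" "p X \<noteq> q X"
    "wide B (Y \<union> X \<union> (D - B) \<inter> set l) k0"
    unfolding found_def m by blast
  show ?r
  proof (cases "v \<in> X")
    case False
    then have "X \<subseteq> B \<inter> set l" using X(1) by auto
    then show ?thesis using X unfolding found_def by blast
  next
    case True
    then obtain X' where X': "X = insert v X'" "v \<notin> X'" by (meson mk_disjoint_insert)
    have "X' \<subseteq> B \<inter> set l" using X(1) X' by auto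
    moreover from this have "finite X'" using finite_subset by blast
    moreover have "insert v Y \<union> X' \<union> (D - B) \<inter> set l = Y \<union> X \<union> (D - B) \<inter> set l" using X' by auto
    ultimately have "found B D k0 l (insert v Y) (k - 1) (\<lambda>X. p (insert v X)) (\<lambda>X. q (insert v X))"
      unfolding found_def using X X' by (intro exI[of _ X']) auto
    moreover have "k > 0" using X(2) X' \<open>finite X'\<close> by auto
    ultimately show ?thesis by blast
  qed
next
  have m: "(D - B) \<inter> set (v # l) = (D - B) \<inter> set l" using assms by auto
  assume ?r
  then show ?l
  proof
    assume "found B D k0 l Y k p q"
    then show ?l unfolding found_def m by auto
  next
    assume "k > 0 \<and> found B D k0 l (insert v Y) (k - 1) (\<lambda>X. p (insert v X)) (\<lambda>X. q (insert v X))"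
    then obtain X where X: "k > 0" "X \<subseteq> B \<inter> set l" "card X = k - 1" "p (insert v X) \<noteq> q (insert v X)"
      "wide B (insert v Y \<union> X \<union> (D - B) \<inter> set l) k0" unfolding found_def by blast
    have "finite X" "v \<notin> X" using X(2) assms finite_subset by blast+
    then have "card (insert v X) = k" using X by simp
    moreover have "insert v Y \<union> X \<union> (D - B) \<inter> set l = Y \<union> insert v X \<union> (D - B) \<inter> set l" by auto
    ultimately show ?l unfolding found_def m using X assms by (intro exI[of _ "insert v X"]) auto
  qed
qed

text \<open>The pair at a leaf is compared by a call whose time is charged to its first component,
  hence the bit bound on p.\<close>

lemma scan_call:
  "vs = pre @ l \<Longrightarrow> Y \<subseteq> set pre \<Longrightarrow> (\<And>X. X \<subseteq> set l \<Longrightarrow> p X < 2 ^ bits) \<Longrightarrow>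
    call 14 [instance_code col, evec vs (ind B), evec l (ind B), evec l (ind D), tree B l p q,
        evec (rev pre) (ind Y), sexp_of_list ks, sexp_of_list k0]
      (sexp_of_bool (found B D (length k0) l Y (length ks) p q))
      (2 ^ br B l * ((length l + 1) * t_scan bits n))"
proof (induction l arbitrary: pre Y p q ks)
  case Nil
  have "call 8 [evec (rev pre) (ind Y), Atom] (evec pre (ind Y)) (t_rev (length pre))"
    using evec_append_rev_call[of pre "ind Y" "[]" "\<lambda>_. 0"] by (simp add: evec_def)
  moreover have "evec pre (ind Y) = evec vs (ind Y)" "length pre = n"
    unfolding n_def using Nil.prems(1) by simp_all
  ultimately have "call 8 [evec (rev pre) (ind Y), Atom] (evec vs (ind Y)) (t_rev n)"
    by (simp only:)
  note r = this[THEN callD]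
  have "call 13 [enc (p {}), enc (q {})] (sexp_of_bool (p {} = q {})) (t_eq bits)"
    using Nil.prems(3) by (intro eq_enc_call) simp
  note e = this[THEN callD]
  note c = reach_call[of col B Y k0, THEN callD]
  show ?case
    by (rule callI, simp)
      (use r e c in \<open>cases "ks = []"; cases "p {} = q {}";
        simp add: program_nth scan_body_def wp_simps t_scan_def br_simps found_Nil\<close>)
next
  case (Cons v l)
  have pre: "vs = (pre @ [v]) @ l" using Cons.prems by simp
  have v: "v \<notin> set pre" "v \<notin> set l" "v \<notin> Y" using distinct_vs Cons.prems by auto
  obtain T where T: "T = 2 ^ br B l * ((length l + 1) * t_scan bits n)" by blast
  have IH: "call 14 [instance_code col, evec vs (ind B), evec l (ind B), evec l (ind D), tree B l p q,
        evec (rev (pre @ [v])) (ind Z), sexp_of_list ks, sexp_of_list k0]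
      (sexp_of_bool (found B D (length k0) l Z (length ks) p q)) T"
    if "Z \<subseteq> set (pre @ [v])" "\<And>X. X \<subseteq> set l \<Longrightarrow> p X < 2 ^ bits" for Z p q ks
    unfolding T by (rule Cons.IH[OF pre that])
  show ?case
  proof (cases "v \<in> B")
    case True
    have "evec (rev (pre @ [v])) (ind Y) = Pair Atom (evec (rev pre) (ind Y))"
      using v by simp
    moreover have "call 14 [instance_code col, evec vs (ind B), evec l (ind B), evec l (ind D),
        tree B l p q,
        evec (rev (pre @ [v])) (ind Y), sexp_of_list ks, sexp_of_list k0]
      (sexp_of_bool (found B D (length k0) l Y (length ks) p q)) T"
      using Cons.prems by (intro IH) auto
    ultimately have "call 14 [instance_code col, evec vs (ind B), evec l (ind B), evec l (ind D),
        tree B l p q,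
        Pair Atom (evec (rev pre) (ind Y)), sexp_of_list ks, sexp_of_list k0]
      (sexp_of_bool (found B D (length k0) l Y (length ks) p q)) T"
      by (simp only:)
    note L = this[THEN callD]
    let ?i = "\<lambda>p X. p (insert v X)"
    have "evec (rev (pre @ [v])) (ind (insert v Y))
        = Pair (Pair (Pair Atom Atom) Atom) (evec (rev pre) (ind Y))"
      using v by (auto intro!: evec_cong)
    moreover have "call 14 [instance_code col, evec vs (ind B), evec l (ind B), evec l (ind D),
        tree B l (?i p) (?i q),
        evec (rev (pre @ [v])) (ind (insert v Y)), sexp_of_list (tl ks), sexp_of_list k0]
      (sexp_of_bool (found B D (length k0) l (insert v Y) (length (tl ks)) (?i p) (?i q))) T"
      using Cons.prems(2) by (intro IH Cons.prems(3)) auto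
    ultimately have "call 14 [instance_code col, evec vs (ind B), evec l (ind B), evec l (ind D),
        tree B l (?i p) (?i q),
        Pair (Pair (Pair Atom Atom) Atom) (evec (rev pre) (ind Y)), sexp_of_list (tl ks), sexp_of_list k0]
      (sexp_of_bool (found B D (length k0) l (insert v Y) (length ks - 1) (?i p) (?i q))) T"
      by (simp only: length_tl)
    note R = this[THEN callD]
    have "call 14 [instance_code col, evec vs (ind B), evec (v # l) (ind B), evec (v # l) (ind D),
        tree B (v # l) p q,
        evec (rev pre) (ind Y), sexp_of_list ks, sexp_of_list k0]
      (sexp_of_bool (found B D (length k0) (v # l) Y (length ks) p q)) (T + T + 100)"
      unfolding found_branch[OF True v(2)]
      by (rule callI, simp)
        (use L R True in \<open>cases "found B D (length k0) l Y (length ks) p q"; cases "ks = []";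
          simp add: program_nth scan_body_def wp_simps\<close>)
    moreover have "T + T + 100 \<le> 2 * 2 ^ br B l * ((Suc (length l) + 1) * t_scan bits n)"
      by (rule branch_time) (simp_all add: T t_scan_def)
    ultimately show ?thesis using True by (elim call_mono) (simp add: br_simps)
  next
    case False
    have "Pair (enc (ind D v)) (evec (rev pre) (ind Y)) = evec (rev (pre @ [v])) (ind (Y \<union> ({v} \<inter> D)))"
      using v by (auto intro!: evec_cong)
    moreover have "call 14 [instance_code col, evec vs (ind B), evec l (ind B), evec l (ind D),
        tree B l p q,
        evec (rev (pre @ [v])) (ind (Y \<union> ({v} \<inter> D))), sexp_of_list ks, sexp_of_list k0]
      (sexp_of_bool (found B D (length k0) l (Y \<union> ({v} \<inter> D)) (length ks) p q)) T"
      using Cons.prems by (intro IH) auto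
    ultimately have "call 14 [instance_code col, evec vs (ind B), evec l (ind B), evec l (ind D),
        tree B l p q,
        Pair (enc (ind D v)) (evec (rev pre) (ind Y)), sexp_of_list ks, sexp_of_list k0]
      (sexp_of_bool (found B D (length k0) l (Y \<union> ({v} \<inter> D)) (length ks) p q)) T"
      by (simp only:)
    note L = this[THEN callD]
    have "call 14 [instance_code col, evec vs (ind B), evec (v # l) (ind B), evec (v # l) (ind D),
        tree B (v # l) p q,
        evec (rev pre) (ind Y), sexp_of_list ks, sexp_of_list k0]
      (sexp_of_bool (found B D (length k0) (v # l) Y (length ks) p q)) (T + 100)"
      unfolding found_skip[OF False]
      by (rule callI, simp) (use L False in \<open>simp add: program_nth scan_body_def wp_simps\<close>)
    moreover have "T + 100 \<le> 2 ^ br B l * ((Suc (length l) + 1) * t_scan bits n)"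
      by (rule skip_time) (simp_all add: T t_scan_def)
    ultimately show ?thesis using False by (elim call_mono) (simp add: br_simps)
  qed
qed

lemma br_le: "br (D \<inter> M) vs \<le> card M"
proof -
  have "br (D \<inter> M) vs = card {v \<in> V. v \<in> D \<inter> M}"
    unfolding br_def using distinct_vs by (metis distinct_card distinct_filter set_filter)
  also have "\<dots> \<le> card M" using finite_subset[OF M_sub] by (intro card_mono) auto
  finally show ?thesis .
qed

text \<open>The program branches on \<open>D \<inter> M\<close> whereas the criterion counts
  vertices outside M. The two counts agree because vertices outside
  \<open>X \<union> (D - M)\<close> are never reached, in particular none of
  \<open>M - D\<close>.\<close>

lemma found_iff_solvable:
  assumes "D \<subseteq> V" "k > 0"
  shows "found (D \<inter> M) D k vs {} k (mob D (2 * k) vs {} True) (mob D (2 * k) vs {} False) \<longleftrightarrow> solvable D k"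
proof -
  have "wide (D \<inter> M) ({} \<union> X \<union> (D - D \<inter> M) \<inter> V) k \<longleftrightarrow>
      k \<le> card {v \<in> V. reach (X \<union> (D - M)) X v > 0 \<and> v \<notin> M}" if X: "X \<subseteq> D \<inter> M" for X
  proof -
    have Z: "{} \<union> X \<union> (D - D \<inter> M) \<inter> V = X \<union> (D - M)" "(X \<union> (D - M)) \<inter> (D \<inter> M) = X"
      using assms X by auto
    have "{v. reach (X \<union> (D - M)) X v > 0} \<subseteq> X \<union> (D - M)"
      unfolding reach_def using closure_subset[OF refl, of X "X \<union> (D - M)" n] by auto
    then have "{v \<in> V. reach (X \<union> (D - M)) X v > 0 \<and> v \<notin> D \<inter> M} =
        {v \<in> V. reach (X \<union> (D - M)) X v > 0 \<and> v \<notin> M}" using X by auto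
    then show ?thesis unfolding wide_def Z by simp
  qed
  moreover have "D \<inter> M \<inter> V = D \<inter> M" using assms by auto
  ultimately show ?thesis
    unfolding solvable_iff[OF assms] found_def accept_def by (metis (no_types, lifting))
qed

lemma decide_call:
  assumes D: "D \<subseteq> V" and ks: "length ks \<le> n"
  shows "call 18 [instance_code col, evec vs (ind M), evec vs (ind D), sexp_of_list ks]
    (sexp_of_bool (solvable D (length ks))) (2 ^ card M * t_decide bits n)"
proof (cases "ks = []")
  case True
  have "call 18 [instance_code col, evec vs (ind M), evec vs (ind D), sexp_of_list ks]
    (sexp_of_bool (solvable D (length ks))) 100"
    by (rule callI, simp) (use True in \<open>simp add: program_nth decide_body_def wp_simps solvable_0\<close>)
  moreover have "100 \<le> t_decide bits n" by (simp add: t_decide_def)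
  moreover have "t_decide bits n \<le> 2 ^ card M * t_decide bits n" by simp
  ultimately show ?thesis by (elim call_mono) linarith
next
  case False
  let ?B = "D \<inter> M" and ?k = "length ks"
  have "call 4 [evec vs (ind D), evec vs (ind M)] (evec vs (\<lambda>v. ind D v * ind M v)) (t_vmul bits n)"
    unfolding n_def using one_bits by (intro vmul_call conjI) auto
  moreover have "(\<lambda>v. ind D v * ind M v) = ind ?B" by auto
  ultimately have "call 4 [evec vs (ind D), evec vs (ind M)] (evec vs (ind ?B)) (t_vmul bits n)" by simp
  note mu = this[THEN callD]
  have "call 8 [sexp_of_list ks, sexp_of_list (tl ks)] (sexp_of_list (rev ks @ tl ks)) (t_rev n)"
    using rev_call[of ks "tl ks"] t_rev_mono[OF ks] by (elim call_mono) auto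
  note r = this[THEN callD]
  have len: "Suc (length (rev ks @ tl ks)) = 2 * ?k" using False by (cases ks) auto
  have sol: "found ?B D ?k vs {} ?k (mob D (2 * ?k) vs {} True) (mob D (2 * ?k) vs {} False) \<longleftrightarrow>
      solvable D ?k"
    using False by (intro found_iff_solvable D) simp
  obtain P where P: "P = (2::nat) ^ card M" by blast
  have pow: "(2::nat) ^ br ?B vs \<le> P" unfolding P by (intro power_increasing br_le) simp
  have "call 12 [instance_code col, evec vs (ind ?B), evec vs (ind D), Atom,
      sexp_of_list (rev ks @ tl ks)]
      (tree ?B vs (mob D (2 * ?k) vs {} True) (mob D (2 * ?k) vs {} False))
      (2 ^ br ?B vs * ((length vs + 1) * t_build bits n))"
    using build_call[of "rev ks @ tl ks" "[]" vs "{}" col D] ks unfolding len by simp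
  then have "call 12 [instance_code col, evec vs (ind ?B), evec vs (ind D), Atom,
      sexp_of_list (rev ks @ tl ks)]
      (tree ?B vs (mob D (2 * ?k) vs {} True) (mob D (2 * ?k) vs {} False))
      (P * ((n + 1) * t_build bits n))"
    using pow by (elim call_mono) (auto simp: n_def intro!: mult_le_mono)
  note b = this[THEN callD]
  have "call 14 [instance_code col, evec vs (ind ?B), evec vs (ind ?B), evec vs (ind D),
        tree ?B vs (mob D (2 * ?k) vs {} True) (mob D (2 * ?k) vs {} False), Atom, sexp_of_list ks,
            sexp_of_list ks]
      (sexp_of_bool (found ?B D ?k vs {} ?k (mob D (2 * ?k) vs {} True) (mob D (2 * ?k) vs {} False)))
      (2 ^ br ?B vs * ((length vs + 1) * t_scan bits n))"
  proof -
    have "1 \<le> 2 * ?k" "2 * ?k \<le> 2 * n" using False ks by (cases ks; simp)+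
    then have "mob D (2 * ?k) vs {} True X < 2 ^ bits" for X
      by (intro mob_bits[of "[]"]) auto
    then show ?thesis
      using scan_call[of "[]" vs "{}" "mob D (2 * ?k) vs {} True" col ?B D "mob D (2 * ?k) vs {} False" ks
          ks]
      by simp
  qed
  then have "call 14 [instance_code col, evec vs (ind ?B), evec vs (ind ?B), evec vs (ind D),
        tree ?B vs (mob D (2 * ?k) vs {} True) (mob D (2 * ?k) vs {} False), Atom, sexp_of_list ks,
            sexp_of_list ks]
      (sexp_of_bool (solvable D ?k)) (P * ((n + 1) * t_scan bits n))"
    using pow unfolding sol
    by (elim call_mono) (auto simp: n_def intro!: mult_le_mono)
  note s = this[THEN callD]
  have "call 18 [instance_code col, evec vs (ind M), evec vs (ind D), sexp_of_list ks]
    (sexp_of_bool (solvable D ?k))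
    (t_vmul bits n + t_rev n + P * ((n + 1) * t_build bits n) + P * ((n + 1) * t_scan bits n) + 300)"
    by (rule callI, simp)
      (use False mu r b s in \<open>simp add: program_nth decide_body_def wp_simps\<close>)
  moreover have "t_vmul bits n + t_rev n + P * ((n + 1) * t_build bits n) + P * ((n + 1) * t_scan bits n)
      + 300
      \<le> P * t_decide bits n"
  proof -
    have "P \<ge> 1" using P by simp
    then have "t_vmul bits n + t_rev n + 300 \<le> P * (t_vmul bits n + t_rev n + 300)" by simp
    moreover have "P * t_decide bits n = P * (t_vmul bits n + t_rev n + 300) +
        P * ((n + 1) * t_build bits n) + P * ((n + 1) * t_scan bits n)"
      unfolding t_decide_def by (simp add: distrib_left)
    ultimately show ?thesis by linarith
  qed
  ultimately show ?thesis unfolding P by (rule call_mono)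
qed

end

section \<open>Search for an optimal solution\<close>

definition t_maximum :: "nat \<Rightarrow> nat \<Rightarrow> nat" where
  "t_maximum L k = (k + 1) * (t_decide L k + 100)"

definition t_prune :: "nat \<Rightarrow> nat \<Rightarrow> nat" where
  "t_prune L k = 100 + k * (t_decide L k + t_rev k + 200)"

definition t_main :: "nat \<Rightarrow> nat \<Rightarrow> nat" where
  "t_main L k = 1000 + 300 * k + t_vadd L k + t_maximum L k + t_prune L k"

context colored_graph
begin

lemma maximum_call:
  "length cs \<le> n \<Longrightarrow> \<exists>ks.
    call 19 [instance_code col, evec vs (ind M), evec vs (ind V), sexp_of_list cs] (sexp_of_list ks)
      ((length cs + 1) * (2 ^ card M * t_decide bits n + 100)) \<and>
    length ks \<le> length cs \<and> solvable V (length ks) \<and>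
    (\<forall>k\<le>length cs. solvable V k \<longrightarrow> k \<le> length ks)"
proof (induction cs)
  case Nil
  note d = decide_call[OF order_refl, of "[]" col, THEN callD]
  have "call 19 [instance_code col, evec vs (ind M), evec vs (ind V), sexp_of_list []] (sexp_of_list [])
      (2 ^ card M * t_decide bits n + 100)"
    by (rule callI, simp) (use d in \<open>simp add: program_nth maximum_body_def wp_simps solvable_0\<close>)
  then show ?case by (intro exI[of _ "[]"]) (simp add: solvable_0)
next
  case (Cons c cs)
  let ?T = "2 ^ card M * t_decide bits n"
  note d = decide_call[OF order_refl Cons.prems, of col, THEN callD]
  show ?case
  proof (cases "solvable V (length (c # cs))")
    case True
    have "call 19 [instance_code col, evec vs (ind M), evec vs (ind V), sexp_of_list (c # cs)]
        (sexp_of_list (c # cs)) (?T + 100)"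
      by (rule callI, simp) (use d True in \<open>simp add: program_nth maximum_body_def wp_simps\<close>)
    then have "call 19 [instance_code col, evec vs (ind M), evec vs (ind V), sexp_of_list (c # cs)]
        (sexp_of_list (c # cs)) ((length (c # cs) + 1) * (?T + 100))"
      by (rule call_mono) simp
    with True show ?thesis by (intro exI[of _ "c # cs"]) simp
  next
    case False
    from Cons obtain ks where ks: "call 19 [instance_code col, evec vs (ind M), evec vs (ind V),
        sexp_of_list cs]
        (sexp_of_list ks) ((length cs + 1) * (?T + 100))"
      "length ks \<le> length cs" "solvable V (length ks)" "\<forall>k\<le>length cs. solvable V k \<longrightarrow> k \<le> length ks"
      by auto
    obtain T where T: "T = (length cs + 1) * (?T + 100)" by blast
    note IH = ks(1)[folded T, THEN callD]
    have "call 19 [instance_code col, evec vs (ind M), evec vs (ind V), sexp_of_list (c # cs)]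
        (sexp_of_list ks) (T + (?T + 100))"
      by (rule callI, simp) (use d IH False in \<open>simp add: program_nth maximum_body_def wp_simps\<close>)
    moreover have "T + (?T + 100) = (length (c # cs) + 1) * (?T + 100)"
      unfolding T by simp
    ultimately show ?thesis using ks False by (intro exI[of _ ks]) (auto simp: le_Suc_eq)
  qed
qed

text \<open>Invariant: the current set is \<open>A \<union> set l\<close>, the survivors of the
  processed prefix together with the vertices not yet examined. Output bits are final at once, since
  later steps never touch an earlier vertex (\<open>prune_outside\<close>).\<close>

lemma prune_call:
  assumes ks: "length ks \<le> n"
  shows "vs = pre @ l \<Longrightarrow> A \<subseteq> set pre \<Longrightarrow>
    call 20 [instance_code col, evec vs (ind M), evec (rev pre) (ind A), evec l (ind V), sexp_of_list ks]
      (sexp_of_list (map (\<lambda>v. sexp_of_bool (v \<in> prune (length ks) (A \<union> set l) l)) l))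
      (100 + length l * (2 ^ card M * t_decide bits n + t_rev n + 200))"
proof (induction l arbitrary: pre A)
  case Nil
  show ?case by (rule callI, simp) (simp add: program_nth prune_body_def wp_simps)
next
  case (Cons v l)
  let ?k = "length ks"
  obtain T where T: "T = 100 + length l * (2 ^ card M * t_decide bits n + t_rev n + 200)" by blast
  have pre: "vs = (pre @ [v]) @ l" using Cons.prems by simp
  have v: "v \<notin> set pre" "v \<notin> set l" "v \<notin> A" "v \<in> V" "A \<union> set l \<subseteq> V"
    using distinct_vs Cons.prems by auto
  have IH: "call 20 [instance_code col, evec vs (ind M), evec (rev (pre @ [v])) (ind Z), evec l (ind V),
      sexp_of_list ks]
      (sexp_of_list (map (\<lambda>w. sexp_of_bool (w \<in> prune ?k (Z \<union> set l) l)) l)) T"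
    if "Z \<subseteq> set (pre @ [v])" for Z
    unfolding T by (rule Cons.IH[OF pre that])
  have mask: "evec vs (ind (A \<union> set l)) = sexp_of_list
      (map (\<lambda>w. enc (ind A w)) pre @ map (\<lambda>w. enc (if w = v then 0 else 1)) (v # l))"
  proof -
    have "map (\<lambda>w. enc (ind (A \<union> set l) w)) vs =
        map (\<lambda>w. enc (ind (A \<union> set l) w)) pre @ map (\<lambda>w. enc (ind (A \<union> set l) w)) (v # l)"
      unfolding Cons.prems(1) by simp
    also have "map (\<lambda>w. enc (ind (A \<union> set l) w)) pre = map (\<lambda>w. enc (ind A w)) pre"
      using distinct_vs unfolding Cons.prems(1) by auto
    also have "map (\<lambda>w. enc (ind (A \<union> set l) w)) (v # l) = map (\<lambda>w. enc (if w = v then 0 else 1)) (v # l)"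
      using v by auto
    finally show ?thesis unfolding evec_def by (rule arg_cong)
  qed
  have "evec (v # l) (\<lambda>w. if w = v then 0 else 1) = Pair Atom (evec l (ind V))"
    using v by (auto intro!: evec_cong)
  with evec_append_rev_call[of pre "ind A" "v # l" "\<lambda>w. if w = v then 0 else 1"]
  have "call 8 [evec (rev pre) (ind A), Pair Atom (evec l (ind V))] (evec vs (ind (A \<union> set l)))
      (t_rev (length pre))"
    unfolding mask by (simp only:)
  moreover have "length pre \<le> n" unfolding n_def using pre by simp
  ultimately have "call 8 [evec (rev pre) (ind A), Pair Atom (evec l (ind V))] (evec vs (ind (A \<union> set l)))
      (t_rev n)"
    using call_mono[OF _ t_rev_mono] by blast
  note r = this[THEN callD]
  note d = decide_call[OF v(5) ks, of col, THEN callD]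
  have D: "A \<union> set (v # l) - {v} = A \<union> set l" using v by auto
  have hd: "enc (ind V v) = Pair (Pair Atom Atom) Atom" using v by simp
  have eq: "call 20 [instance_code col, evec vs (ind M), evec (rev pre) (ind A), evec (v # l) (ind V),
      sexp_of_list ks]
      (sexp_of_list (map (\<lambda>w. sexp_of_bool (w \<in> prune ?k (A \<union> set (v # l)) (v # l))) (v # l)))
      (T + (2 ^ card M * t_decide bits n + t_rev n + 200))"
  proof (cases "solvable (A \<union> set l) ?k")
    case True
    have "call 20 [instance_code col, evec vs (ind M), Pair Atom (evec (rev pre) (ind A)), evec l (ind V),
        sexp_of_list ks]
        (sexp_of_list (map (\<lambda>w. sexp_of_bool (w \<in> prune ?k (A \<union> set l) l)) l)) T"
      using IH[of A] Cons.prems v by auto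
    note IH' = this[THEN callD]
    have p: "prune ?k (A \<union> set (v # l)) (v # l) = prune ?k (A \<union> set l) l"
      unfolding prune.simps D using True by simp
    have "v \<notin> prune ?k (A \<union> set l) l" using prune_outside[OF v(2)] v by auto
    then show ?thesis
      unfolding p
      by (intro callI, simp)
        (use r d IH' True hd in \<open>simp add: program_nth prune_body_def wp_simps\<close>)
  next
    case False
    have "evec (rev (pre @ [v])) (ind (insert v A))
        = Pair (Pair (Pair Atom Atom) Atom) (evec (rev pre) (ind A))"
      using v by (auto intro!: evec_cong)
    then have "call 20 [instance_code col, evec vs (ind M),
        Pair (Pair (Pair Atom Atom) Atom) (evec (rev pre) (ind A)),
        evec l (ind V), sexp_of_list ks]
        (sexp_of_list (map (\<lambda>w. sexp_of_bool (w \<in> prune ?k (insert v A \<union> set l) l)) l)) T"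
      using IH[of "insert v A"] Cons.prems by auto
    note IH' = this[THEN callD]
    have "A \<union> set (v # l) = insert v A \<union> set l" by auto
    then have p: "prune ?k (A \<union> set (v # l)) (v # l) = prune ?k (insert v A \<union> set l) l"
      unfolding prune.simps D using False by simp
    have "v \<in> prune ?k (insert v A \<union> set l) l" using prune_outside[OF v(2)] by auto
    then show ?thesis
      unfolding p
      by (intro callI, simp)
        (use r d IH' False hd in \<open>simp add: program_nth prune_body_def wp_simps\<close>)
  qed
  moreover have "T + (2 ^ card M * t_decide bits n + t_rev n + 200) =
      100 + length (v # l) * (2 ^ card M * t_decide bits n + t_rev n + 200)"
    unfolding T by (simp add: algebra_simps)
  ultimately show ?case by (simp only:)
qed

end

lemma half_call:
  "call 21 [sexp_of_list (map (\<lambda>v. Pair (sexp_of_bool (col v)) (r v)) l), sexp_of_list ks]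
     (sexp_of_list (drop (2 * length (filter col l)) ks)) (100 + 100 * length l)"
proof (induction l arbitrary: ks)
  case Nil
  show ?case by (rule callI, simp) (simp add: program_nth half_body_def wp_simps)
next
  case (Cons v l)
  have t: "tl (tl ks) = drop 2 ks" by (simp add: drop_Suc numeral_2_eq_2)
  note IH = Cons.IH[of ks, THEN callD] Cons.IH[of "drop 2 ks", THEN callD]
  show ?case
    by (rule callI, simp) (use IH in \<open>cases "col v"; simp add: program_nth half_body_def wp_simps t
        add.commute\<close>)
qed

lemma minor_call:
  "call 22 [sexp_of_list (map (\<lambda>v. Pair (sexp_of_bool (col v)) (r v)) l), f]
     (evec l (\<lambda>v. of_bool (col v \<longleftrightarrow> f \<noteq> Atom))) (100 + 100 * length l)"
proof (induction l)
  case Nil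
  show ?case by (rule callI, simp) (simp add: program_nth minor_body_def wp_simps)
next
  case (Cons v l)
  show ?case
    by (rule callI, simp)
      (use Cons.IH[THEN callD] in \<open>cases "col v"; cases "f = Atom"; simp add: program_nth minor_body_def
          wp_simps\<close>)
qed

context listed_graph
begin

text \<open>In a tie the blue vertices are chosen, in agreement with the test made by
  \<open>half_body\<close>.\<close>

definition minority :: "('a \<Rightarrow> bool) \<Rightarrow> 'a set" where
  "minority col = {v \<in> V. col v \<longleftrightarrow> 2 * length (filter col vs) \<le> n}"

lemma card_minority: "card (minority col) \<le> n div 2"
proof (cases "2 * length (filter col vs) \<le> n")
  case True
  then have "minority col = set (filter col vs)" by (auto simp: minority_def)
  then have "card (minority col) \<le> length (filter col vs)" by (metis card_length)
  then show ?thesis using True by simp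
next
  case False
  then have "minority col = set (filter (\<lambda>v. \<not> col v) vs)" by (auto simp: minority_def)
  then have "card (minority col) \<le> length (filter (\<lambda>v. \<not> col v) vs)" by (metis card_length)
  moreover have "length (filter col vs) + length (filter (\<lambda>v. \<not> col v) vs) = n"
    unfolding n_def by (rule sum_length_filter_compl)
  ultimately show ?thesis using False by simp
qed

lemma colored_graph_minority: "colored_graph vs E (minority col)"
  by unfold_locales (auto simp: minority_def)

lemma main_call:
  fixes col :: "'a \<Rightarrow> bool"
  defines "M \<equiv> minority col"
  shows "\<exists>F k. call 0 [instance_code col] (sexp_of_list (map (\<lambda>v. sexp_of_bool (v \<in> F)) vs))
      (2 ^ (n div 2) * t_main bits n) \<and>
    colored_graph.solution E M V k F \<and> (\<forall>k'. colored_graph.solvable E M V k' \<longrightarrow> k' \<le> k)"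
proof -
  interpret colored_graph vs E M unfolding M_def by (rule colored_graph_minority)
  \<comment> \<open>A list of length n + 1 loses two cells per blue vertex, so something remains iff
    twice the number of blue vertices is at most n. The additional cell makes the tie count as
    blue.\<close>
  let ?f = "sexp_of_list (drop (2 * length (filter col vs))
      (Atom # map (\<lambda>v. Pair (sexp_of_bool (col v)) (sexp_of_list (map (\<lambda>w. sexp_of_bool (E v w)) vs)))
      vs))"
  have f: "?f \<noteq> Atom \<longleftrightarrow> 2 * length (filter col vs) \<le> n" by (auto simp: n_def)
  have "call 21 [instance_code col, Pair Atom (instance_code col)] ?f (100 + 100 * n)"
    using half_call[of col "\<lambda>v. sexp_of_list (map (\<lambda>w. sexp_of_bool (E v w)) vs)" vs] 
    by (simp only: instance_code_def n_def sexp_of_list.simps(2)[symmetric])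
  note h = this[THEN callD]
  have minor: "call 22 [instance_code col, g] (evec vs (\<lambda>v. of_bool (col v \<longleftrightarrow> g \<noteq> Atom))) (100 + 100 * n)"
      for g
    unfolding instance_code_def n_def by (rule minor_call)
  have "evec vs (\<lambda>v. of_bool (col v \<longleftrightarrow> ?f \<noteq> Atom)) = evec vs (ind M)"
    unfolding f M_def minority_def by (rule evec_cong) simp
  with minor[of ?f] have "call 22 [instance_code col, ?f] (evec vs (ind M)) (100 + 100 * n)"
      by (simp only:)
  note m1 = this[THEN callD]
  let ?g = "if ?f = Atom then Pair Atom Atom else Atom"
  have "evec vs (\<lambda>v. of_bool (col v \<longleftrightarrow> ?g \<noteq> Atom)) = evec vs (ind (V - M))"
    using f unfolding M_def minority_def by (intro evec_cong) auto
  with minor[of ?g] have "call 22 [instance_code col, ?g] (evec vs (ind (V - M))) (100 + 100 * n)"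
      by (simp only:)
  note m2 = this[THEN callD]
  have "call 3 [evec vs (ind M), evec vs (ind (V - M))] (evec vs (\<lambda>v. ind M v + ind (V - M) v))
      (t_vadd bits n)"
    unfolding n_def using one_bits by (intro vadd_call conjI) auto
  moreover have "evec vs (\<lambda>v. ind M v + ind (V - M) v) = evec vs (ind V)"
    using M_sub by (intro evec_cong) auto
  ultimately have "call 3 [evec vs (ind M), evec vs (ind (V - M))] (evec vs (ind V)) (t_vadd bits n)"
    by (simp only:)
  note ad = this[THEN callD]
  obtain P where P: "P = (2::nat) ^ card M" by blast
  define cs where "cs = map (\<lambda>v. Pair (sexp_of_bool (col v))
      (sexp_of_list (map (\<lambda>w. sexp_of_bool (E v w)) vs))) vs"
  have cs: "sexp_of_list cs = instance_code col" "length cs = n"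
    by (simp_all add: cs_def instance_code_def n_def)
  obtain ks where ks: "call 19 [instance_code col, evec vs (ind M), evec vs (ind V),
      sexp_of_list cs] (sexp_of_list ks)
      ((length cs + 1) * (2 ^ card M * t_decide bits n + 100))"
      "length ks \<le> length cs" "solvable V (length ks)" "\<forall>k\<le>length cs. solvable V k \<longrightarrow> k \<le> length ks"
    using maximum_call[of cs] cs by auto
  note mx = ks(1)[unfolded cs, THEN callD]
  let ?F = "prune (length ks) V vs"
  have "length ks \<le> n" using ks(2) cs by simp
  from prune_call[OF this, of "[]" vs "{}" col]
  have "call 20 [instance_code col, evec vs (ind M), Atom, evec vs (ind V), sexp_of_list ks]
      (sexp_of_list (map (\<lambda>v. sexp_of_bool (v \<in> ?F)) vs))
      (100 + n * (2 ^ card M * t_decide bits n + t_rev n + 200))"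
    by (simp add: n_def)
  note pr = this[THEN callD]
  let ?T = "500 + 300 * n + t_vadd bits n + (n + 1) * (2 ^ card M * t_decide bits n + 100)
      + (100 + n * (2 ^ card M * t_decide bits n + t_rev n + 200))"
  have "call 0 [instance_code col] (sexp_of_list (map (\<lambda>v. sexp_of_bool (v \<in> ?F)) vs)) ?T"
  proof (rule callI, simp)
    show "wp [instance_code col] (bcs_program ! 0)
      (\<lambda>y t. y = sexp_of_list (map (\<lambda>v. sexp_of_bool (v \<in> ?F)) vs) \<and> t \<le> ?T)"
    proof (cases "?f = Atom")
      case True
      show ?thesis
        using h m1 m2 ad mx pr unfolding if_P[OF True] True
        by (simp add: program_nth main_body_def wp_simps)
    next
      case False
      obtain f where fdef: "f = ?f" by blast
      from False show ?thesis
        using h m1 m2 ad mx pr unfolding if_not_P[OF False] fdef[symmetric]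
        by (simp add: program_nth main_body_def wp_simps)
    qed
  qed
  moreover have "?T \<le> 2 ^ (n div 2) * t_main bits n"
  proof -
    \<comment> \<open>Here the minority having at most n div 2 vertices replaces the exponent
      \<open>card M\<close> by one depending on n only.\<close>
    let ?Q = "(2::nat) ^ (n div 2)"
    have "2 ^ card M \<le> ?Q" using card_minority[of col] unfolding M_def by (intro power_increasing) auto
    then have "2 ^ card M * t_decide bits n \<le> ?Q * t_decide bits n" by (rule mult_le_mono1)
    then have d: "k * (2 ^ card M * t_decide bits n + c) \<le> ?Q * (k * (t_decide bits n + c))" for k c
    proof -
      have "k * (2 ^ card M * t_decide bits n + c) \<le> k * (?Q * t_decide bits n + ?Q * c)"
        using \<open>2 ^ card M * t_decide bits n \<le> ?Q * t_decide bits n\<close>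
        by (intro mult_le_mono2 add_mono) simp_all
      then show ?thesis by (simp only: distrib_left mult.assoc mult.left_commute)
    qed
    have "1000 + 300 * n + t_vadd bits n \<le> ?Q * (1000 + 300 * n + t_vadd bits n)" by simp
    with d[of "n + 1" 100] d[of n "t_rev n + 200"]
    have "1000 + 300 * n + t_vadd bits n + (n + 1) * (2 ^ card M * t_decide bits n + 100)
        + n * (2 ^ card M * t_decide bits n + (t_rev n + 200)) \<le>
      ?Q * (1000 + 300 * n + t_vadd bits n) + ?Q * ((n + 1) * (t_decide bits n + 100)) + ?Q *
          (n * (t_decide bits n + (t_rev n + 200)))"
      by linarith
    also have "\<dots> \<le> ?Q * t_main bits n"
      unfolding t_main_def t_maximum_def t_prune_def distrib_left[symmetric]
      by (intro mult_le_mono2) (simp add: add.assoc)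
    finally show ?thesis by (simp add: add.assoc)
  qed
  ultimately have "call 0 [instance_code col] (sexp_of_list (map (\<lambda>v. sexp_of_bool (v \<in> ?F)) vs))
      (2 ^ (n div 2) * t_main bits n)"
    by (rule call_mono)
  moreover have "solution V (length ks) ?F" using ks(3) by (intro prune_solution) auto
  moreover have "k' \<le> length ks" if "solvable V k'" for k'
    using ks(4) that solvable_le[OF order_refl that] cs by simp
  ultimately show ?thesis by blast
qed

end

section \<open>Relation to connected induced subgraphs\<close>

lemma connected_iff_cut_connected:
  assumes "sym (parcs H)"
  shows "Digraph_Component.connected (with_proj H) \<longleftrightarrow> cut_connected (\<lambda>u v. (u, v) \<in> parcs H) (pverts H)"
    (is "_ \<longleftrightarrow> cut_connected ?E ?S")
proof -
  have "(parcs H)\<^sup>s = parcs H" using assms by (auto simp: symcl_def dest: symD)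
  then have conn: "Digraph_Component.connected (with_proj H) \<longleftrightarrow>
      ?S \<noteq> {} \<and> (\<forall>u\<in>?S. \<forall>v\<in>?S. (u, v) \<in> rtrancl_on ?S (parcs H))"
    by (simp add: connected_conv)
  show ?thesis
  proof
    assume c: "Digraph_Component.connected (with_proj H)"
    show "cut_connected ?E ?S"
      unfolding cut_connected_def
    proof (intro conjI allI impI)
      show "?S \<noteq> {}" using c conn by blast
    next
      fix T assume T: "T \<subset> ?S" "T \<noteq> {}"
      then obtain u v where uv: "u \<in> T" "v \<in> ?S" "v \<notin> T" by blast
      then have "(u, v) \<in> rtrancl_on ?S (parcs H)" using c conn T by blast
      \<comment> \<open>A path from u in T to v outside T uses an arc that leaves T.\<close>
      then have "v \<notin> T \<longrightarrow> (\<exists>x\<in>T. \<exists>y\<in>?S - T. (x, y) \<in> parcs H)"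
        by (induction rule: rtrancl_on_induct) (use uv in blast)+
      then show "\<exists>x\<in>T. \<exists>y\<in>?S - T. (x, y) \<in> parcs H" using uv by blast
    qed
  next
    assume c: "cut_connected ?E ?S"
    have "(u, v) \<in> rtrancl_on ?S (parcs H)" if "u \<in> ?S" "v \<in> ?S" for u v
    proof (rule ccontr)
      assume no: "(u, v) \<notin> rtrancl_on ?S (parcs H)"
      \<comment> \<open>The vertices reachable from u would form a cut that no arc leaves.\<close>
      let ?T = "{w. (u, w) \<in> rtrancl_on ?S (parcs H)}"
      have "?S \<inter> ?T \<noteq> {}" "\<not> ?S \<subseteq> ?T" using that no by auto
      with c obtain x y where "x \<in> ?S \<inter> ?T" "y \<in> ?S - ?T" "(x, y) \<in> parcs H"
        by (rule cut_connectedE)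
      then show False by (auto intro: rtrancl_on_into_rtrancl_on)
    qed
    then show "Digraph_Component.connected (with_proj H)"
      using conn cut_connected_nonempty[OF c] by blast
  qed
qed

lemma cut_connected_cong:
  "(\<And>x y. x \<in> S \<Longrightarrow> y \<in> S \<Longrightarrow> E x y \<longleftrightarrow> E' x y) \<Longrightarrow> cut_connected E S \<longleftrightarrow> cut_connected E' S"
  unfolding cut_connected_def by (metis Diff_iff psubsetD)

lemma induced_subgraph_iff:
  assumes "pair_wf_digraph G"
  shows "induced_subgraph (with_proj H) (with_proj G) \<longleftrightarrow>
    pverts H \<subseteq> pverts G \<and> parcs H = {e \<in> parcs G. fst e \<in> pverts H \<and> snd e \<in> pverts H}"
proof -
  interpret G: pair_wf_digraph G by fact
  have "wf_digraph (with_proj H)" if "parcs H = {e \<in> parcs G. fst e \<in> pverts H \<and> snd e \<in> pverts H}"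
    by unfold_locales (use that in auto)
  then show ?thesis
    using G.wf_digraph_axioms by (auto simp: induced_subgraph_def subgraph_def compatible_def)
qed

lemma BCS_feasible_iff:
  fixes G :: "'a pair_pre_digraph"
  assumes "bicolored_graph G B R"
  shows "BCS_feasible G B R H \<longleftrightarrow>
    pverts H \<subseteq> pverts G \<and> parcs H = {e \<in> parcs G. fst e \<in> pverts H \<and> snd e \<in> pverts H} \<and>
    (pverts H = {} \<or> cut_connected (\<lambda>u v. (u, v) \<in> parcs G) (pverts H)) \<and>
    card (pverts H \<inter> B) = card (pverts H - B)"
proof -
  interpret G: pair_graph G using assms by (simp add: bicolored_graph_def)
  have sym: "sym (parcs G)" using G.pair_sym_arcs by (simp add: symmetric_def)
  have R: "pverts H \<inter> R = pverts H - B" if "pverts H \<subseteq> pverts G"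
    using that assms by (auto simp: bicolored_graph_def)
  have "Digraph_Component.connected (with_proj H) \<longleftrightarrow> cut_connected (\<lambda>u v. (u, v) \<in> parcs G) (pverts H)"
    if H: "parcs H = {e \<in> parcs G. fst e \<in> pverts H \<and> snd e \<in> pverts H}"
  proof -
    have "sym (parcs H)" unfolding H using sym by (auto simp: sym_def)
    from connected_iff_cut_connected[OF this] show ?thesis
      using cut_connected_cong[of "pverts H" "\<lambda>u v. (u, v) \<in> parcs H" "\<lambda>u v. (u, v) \<in> parcs G"]
      by (simp add: H)
  qed
  then show ?thesis
    unfolding BCS_feasible_def induced_subgraph_iff[OF G.pair_wf_digraph_axioms] using R by auto
qed

section \<open>Polynomial time bounds\<close>

definition poly_bounded :: "(nat \<Rightarrow> nat) \<Rightarrow> bool" where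
  "poly_bounded f \<longleftrightarrow> (\<exists>c d. \<forall>k. f k \<le> c * (k + 1) ^ d)"

lemma poly_bounded_const: "poly_bounded (\<lambda>_. c)"
  unfolding poly_bounded_def by (intro exI[of _ c] exI[of _ 0]) simp

lemma poly_bounded_id: "poly_bounded (\<lambda>k. k)"
  unfolding poly_bounded_def by (intro exI[of _ 1] exI[of _ 1]) simp

lemma poly_bounded_add:
  assumes "poly_bounded f" "poly_bounded g"
  shows "poly_bounded (\<lambda>k. f k + g k)"
proof -
  from assms obtain c d c' d' where f: "\<And>k. f k \<le> c * (k + 1) ^ d" and g: "\<And>k. g k \<le> c' * (k + 1) ^ d'"
    by (auto simp: poly_bounded_def)
  \<comment> \<open>With base k + 1, which is at least 1, the exponent d + d' dominates both d and
    d'.\<close>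
  have "f k + g k \<le> (c + c') * (k + 1) ^ (d + d')" for k
  proof -
    have "f k \<le> c * (k + 1) ^ (d + d')"
      by (rule order_trans[OF f]) (intro mult_le_mono2 power_increasing; simp)
    moreover have "g k \<le> c' * (k + 1) ^ (d + d')"
      by (rule order_trans[OF g]) (intro mult_le_mono2 power_increasing; simp)
    ultimately show ?thesis by (simp add: distrib_right)
  qed
  then show ?thesis unfolding poly_bounded_def by blast
qed

lemma poly_bounded_mult:
  assumes "poly_bounded f" "poly_bounded g"
  shows "poly_bounded (\<lambda>k. f k * g k)"
proof -
  from assms obtain c d c' d' where f: "\<And>k. f k \<le> c * (k + 1) ^ d" and g: "\<And>k. g k \<le> c' * (k + 1) ^ d'"
    by (auto simp: poly_bounded_def)
  have "f k * g k \<le> (c * c') * (k + 1) ^ (d + d')" for k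
    using mult_le_mono[OF f[of k] g[of k]] by (simp only: power_add ac_simps)
  then show ?thesis unfolding poly_bounded_def by blast
qed

lemmas poly_bounded_intros = poly_bounded_const poly_bounded_id poly_bounded_add poly_bounded_mult

text \<open>The bit length is written out as a polynomial in k, which turns a time bound in two
  parameters into a function of the number of vertices alone.\<close>

lemma poly_bounded_t_total: "poly_bounded (\<lambda>k. t_total (4 * k * k + 4 * k + 1) k)"
  unfolding t_total_def t_walks_def t_conv_def t_matvec_def t_dot_def t_rev_def t_vadd_def t_vmul_def
    t_mul_def t_add_def
  by (intro poly_bounded_intros)

lemma poly_bounded_t_reach: "poly_bounded (\<lambda>k. t_reach (4 * k * k + 4 * k + 1) k)"
  unfolding t_reach_def t_closure_def t_atleast_def t_matvec_def t_dot_def t_vadd_def t_vmul_def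
    t_mul_def t_add_def
  by (intro poly_bounded_intros)

lemma poly_bounded_t_decide: "poly_bounded (\<lambda>k. t_decide (4 * k * k + 4 * k + 1) k)"
  unfolding t_decide_def t_build_def t_scan_def t_sub_def t_eq_def t_rev_def t_vmul_def t_mul_def
      t_add_def
  by (intro poly_bounded_intros poly_bounded_t_total poly_bounded_t_reach)

lemma poly_bounded_t_main: "poly_bounded (\<lambda>k. t_main (4 * k * k + 4 * k + 1) k + 2)"
  unfolding t_main_def t_maximum_def t_prune_def t_vadd_def t_rev_def t_add_def
  by (intro poly_bounded_intros poly_bounded_t_decide)

lemma O_star_pow_half:
  assumes "poly_bounded f"
  shows "(\<lambda>k. real (2 ^ (k div 2) * f k)) \<in> O_star (\<lambda>k. 2 powr (real k / 2))"
proof -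
  obtain c d where f: "\<And>k. f k \<le> c * (k + 1) ^ d" using assms by (auto simp: poly_bounded_def)
  \<comment> \<open>\<open>[:1, 1:]\<close> is the polynomial x + 1, so the witness is c(x +
    1)^d.\<close>
  have "real (2 ^ (k div 2) * f k) \<le> poly (smult (real c) ([:1, 1:] ^ d)) (real k) * 2 powr (real k / 2)"
      for k
  proof -
    have "real (f k) \<le> real (c * (k + 1) ^ d)" using f by (simp only: of_nat_le_iff)
    also have "\<dots> = poly (smult (real c) ([:1, 1:] ^ d)) (real k)" by (simp add: algebra_simps)
    finally have "real (f k) \<le> poly (smult (real c) ([:1, 1:] ^ d)) (real k)" .
    moreover have "real (2 ^ (k div 2)) \<le> 2 powr (real k / 2)"
    proof -
      have "real (2 * (k div 2)) \<le> real k" unfolding of_nat_le_iff by simp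
      then have half: "real (k div 2) \<le> real k / 2" by simp
      have "real (2 ^ (k div 2)) = 2 powr real (k div 2)" by (simp add: powr_realpow)
      also have "\<dots> \<le> 2 powr (real k / 2)" using half by (intro powr_mono) auto
      finally show ?thesis .
    qed
    ultimately have "real (f k) * real (2 ^ (k div 2)) \<le>
        poly (smult (real c) ([:1, 1:] ^ d)) (real k) * 2 powr (real k / 2)"
      by (intro mult_mono) auto
    then show ?thesis by (simp add: mult.commute)
  qed
  then show ?thesis unfolding O_star_def by blast
qed

theorem theorem10:
  shows "\<exists>P. \<exists>T \<in> O_star (\<lambda>n. 2 powr (real n / 2)). solves_BCS_in_time P T"
proof (intro exI bexI)
  let ?t = "\<lambda>k. 2 ^ (k div 2) * (t_main (4 * k * k + 4 * k + 1) k + 2)"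
  show "(\<lambda>k. real (?t k)) \<in> O_star (\<lambda>n. 2 powr (real n / 2))"
    by (rule O_star_pow_half[OF poly_bounded_t_main])
  show "solves_BCS_in_time bcs_program (\<lambda>k. real (?t k))"
    unfolding solves_BCS_in_time_def
  proof (intro allI impI)
    fix G :: "nat pair_pre_digraph" and B R vs
    assume bi: "bicolored_graph G B R" and vs: "distinct vs" "set vs = pverts G"
    interpret G: pair_graph G using bi by (simp add: bicolored_graph_def)
    let ?E = "\<lambda>u v. (u, v) \<in> parcs G"
    have "sym (parcs G)" using G.pair_sym_arcs by (simp add: symmetric_def)
    then interpret listed_graph vs ?E
      by unfold_locales (auto simp: vs sym_def symp_def)
    let ?col = "\<lambda>v. v \<in> B"
    interpret colored_graph vs ?E "minority ?col" by (rule colored_graph_minority)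
    have card: "card (pverts G) = n" using vs by (metis n_def distinct_card)
    have code: "encode_instance vs G B = instance_code ?col"
      by (simp add: encode_instance_def instance_code_def)
    obtain F k where F: "call 0 [instance_code ?col] (sexp_of_list (map (\<lambda>v. sexp_of_bool (v \<in> F)) vs))
        (2 ^ (n div 2) * t_main bits n)"
      "solution V k F" "\<And>k'. solvable V k' \<Longrightarrow> k' \<le> k"
      using main_call[of ?col] by blast
    \<comment> \<open>The minority is the blue class or its complement in the vertex set; exchanging
      the two classes does not affect balance.\<close>
    have balanced: "card (S \<inter> B) = card (S - B) \<longleftrightarrow> card (S \<inter> minority ?col) = card (S - minority ?col)"
      if "S \<subseteq> V" for S
    proof -
      have "S \<inter> minority ?col = S \<inter> B \<and> S - minority ?col = S - B \<or>
          S \<inter> minority ?col = S - B \<and> S - minority ?col = S \<inter> B"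
        unfolding minority_def using that by (cases "2 * length (filter ?col vs) \<le> n") auto
      then show ?thesis by auto
    qed
    define H where "H = \<lparr>pverts = F, parcs = {e \<in> parcs G. fst e \<in> F \<and> snd e \<in> F}\<rparr>"
    have FV: "F \<subseteq> V" using F(2) by (simp add: solution_def)
    have "BCS_feasible G B R H"
      unfolding BCS_feasible_iff[OF bi] using F(2) balanced[OF FV] by (auto simp: H_def solution_def vs)
    moreover have "card (pverts H') \<le> card (pverts H)" if "BCS_feasible G B R H'" for H'
    proof -
      let ?S = "pverts H'" and ?M = "minority ?col"
      have S: "?S \<subseteq> V" "?S = {} \<or> cut_connected ?E ?S" "card (?S \<inter> B) = card (?S - B)"
        using that unfolding BCS_feasible_iff[OF bi] vs by auto
      then have "solution V (card (?S \<inter> ?M)) ?S" using balanced[OF S(1)] by (simp add: solution_def)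
      then have "card (?S \<inter> ?M) \<le> k" by (intro F(3)) (auto simp: solvable_def)
      moreover have "card ?S = 2 * card (?S \<inter> ?M)"
        using card_Int_Diff[of ?S ?M] finite_subset[OF S(1)] S(3) balanced[OF S(1)] by simp
      moreover have "card F = 2 * k"
        using card_Int_Diff[of F ?M] finite_subset[OF FV] F(2) by (simp add: solution_def)
      ultimately show ?thesis by (simp add: H_def)
    qed
    ultimately have opt: "BCS_optimal G B R H" by (simp add: BCS_optimal_def)
    from F(1) obtain t where t: "t \<le> 2 ^ (n div 2) * t_main bits n"
      "eval bcs_program [instance_code ?col] (bcs_program ! 0) (encode_vertex_set vs F) t"
          "0 < length bcs_program"
      by (auto simp: call_def wpc_def wp_def encode_vertex_set_def)
    \<comment> \<open>Starting the program costs two steps beyond its body, one for the argument and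
      one for the call; they are the summand 2 in the time bound.\<close>
    have "evals bcs_program [instance_code ?col] [EVar 0] [instance_code ?col] (1 + 0)"
      using eval_Var[of 0 "[instance_code ?col]" bcs_program] by (intro evals_Cons evals_Nil) simp
    then have "computes_in bcs_program (instance_code ?col) (encode_vertex_set vs F) (1 + 0 + t + 1)"
      unfolding computes_in_def by (rule eval_Call[OF _ t(3,2)])
    moreover have "1 + 0 + t + 1 \<le> ?t n"
    proof -
      have "2 \<le> 2 ^ (n div 2) * (2::nat)" by simp
      then have "t + 2 \<le> 2 ^ (n div 2) * (t_main bits n + 2)" using t(1) unfolding distrib_left
          by linarith
      then show ?thesis by (simp add: bits_def)
    qed
    ultimately show "\<exists>H t. computes_in bcs_program (encode_instance vs G B)
        (encode_vertex_set vs (pverts H)) t \<and>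
        BCS_optimal G B R H \<and> real t \<le> real (?t (card (pverts G)))"
      unfolding code card
      by (intro exI[of _ H] exI[of _ "1 + 0 + t + 1"] conjI opt)
          (simp_all only: H_def pair_pre_digraph.simps of_nat_le_iff)
  qed
qed

end
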